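(* Let $(M,\Omega,\mathbb{T},\mu)$ be a compact toric symplectic manifold of dimension $2n$, let $I\in K_\Omega^{\mathbb{T}}(M)$ be a toric Kähler structure with symplectic potential $\tau$ on $\mathring\Delta$, and let $C$ be any $n\times n$ anti-symmetric constant matrix. Then the pair $(\tau,C)$ gives rise to an element of $DGK_\Omega^{\mathbb{T}}(M)$: with $\psi=\mathrm{Hess}(\tau)$ and $\phi=\psi+C$, the almost complex structure $J_+$ on $\mathring M$ given in admissible coordinates $(\theta_j,\mu_j)$ of $I$ by $$J_+\partial_{\mu_k}=\sum_j\phi_{kj}\partial_{\theta_j},\qquad J_+\partial_{\theta_k}=-\sum_j(\phi^{-1})_{kj}\partial_{\mu_j}$$ is the restriction to $\mathring M$ of an element of $DGK_\Omega^{\mathbb{T}}(M)$.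
   Context: Setting. $M$ is a compact connected manifold of dimension $2n$ with symplectic form $\Omega$ and an effective Hamiltonian action of the torus $\mathbb{T}=\mathbb{T}^n$ with moment map $\mu:M\to\mathfrak{t}^*$. Fix a basis $\{e_j\}$ of $\mathfrak{t}$, let $X_j$ be the fundamental vector fields and $\mu_j$ the components of $\mu$; convention $\iota_{X_j}\Omega=-d\mu_j$. $\Delta=\mu(M)$ is the moment polytope, $\mathring\Delta$ its interior, $\mathring M=\mu^{-1}(\mathring\Delta)$. Conventions. 2-forms are regarded as maps $TM\to T^*M$, $X\mapsto\iota_X(\cdot)$; $(J^*\alpha)(X)=\alpha(JX)$. $GK_\Omega^{\mathbb T}(M)$ is the set of $\mathbb{T}$-invariant integrable complex structures $J_+$ on $M$ that are tamed by $\Omega$ (i.e. $\Omega(X,J_+X)>0$ for $X\ne0$) and for which $J_-:=-\Omega^{-1}J_+^*\Omega$ is also integrable (these parametrize $\mathbb{T}$-invariant generalized Kähler structures of symplectic type). $DGK_\Omega^{\mathbb T}(M)$ is the subset with $J_+\mathcal D=J_-\mathcal D$ on $\mathring M$, where $\mathcal D=\mathrm{span}\{X_j\}$. $K_\Omega^{\mathbb T}(M)$ is the set of $\mathbb{T}$-invariant complex structures on $M$ compatible with $\Omega$, i.e. toric Kähler structures. Admissible coordinates and symplectic potential of $I\in K_\Omega^{\mathbb T}(M)$. $\{X_j,IX_j\}$ is a frame on $\mathring M$; the first half $\{\zeta_j\}$ of the dual coframe is closed, locally $\zeta_j=d\theta_j$, and $(\theta_j,\mu_j)$ are coordinates on $\mathring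 M$ with $\partial_{\theta_j}=X_j$ and $\Omega=\sum_j d\mu_j\wedge d\theta_j$. In them $I\partial_{\mu_k}=\sum_j\psi_{kj}\partial_{\theta_j}$ where $\psi$ is a symmetric positive-definite matrix function on $\mathring\Delta$ which is the Hessian of a function $\tau$ on $\mathring\Delta$, the symplectic potential of $I$. *)

theory Defs
  imports "HOL-Analysis.Analysis"
begin

section \<open>Smooth maps between Euclidean spaces\<close>

text \<open>Only used for open \<^term>\<open>S\<close>; then \<^term>\<open>Ck_on k f S\<close> says that all iterated directional
  derivatives of order at most \<^term>\<open>k\<close> exist (as Frechet derivatives) and are continuous.\<close>

primrec Ck_on ::
    "nat \<Rightarrow> ('b::real_normed_vector \<Rightarrow> 'c::real_normed_vector) \<Rightarrow> 'b set \<Rightarrow> bool" where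
  "Ck_on 0 f S \<longleftrightarrow> continuous_on S f"
| "Ck_on (Suc k) f S \<longleftrightarrow> (\<forall>x\<in>S. f differentiable (at x)) \<and>
     (\<forall>v. Ck_on k (\<lambda>x. frechet_derivative f (at x) v) S)"

definition smooth_on ::
    "'b set \<Rightarrow> ('b::real_normed_vector \<Rightarrow> 'c::real_normed_vector) \<Rightarrow> bool" where
  "smooth_on S f \<longleftrightarrow> (\<forall>k. Ck_on k f S)"

section \<open>Smooth manifolds\<close>

text \<open>The manifold is a whole type \<^typ>\<open>'a\<close> (Hausdorff, second countable), modelled on a Euclidean
  space \<^typ>\<open>'b\<close>.  A chart is a domain with a coordinate map, whose values off the domain
  are irrelevant.  The structure is a maximal atlas, so every local coordinate system is a member.\<close>

type_synonym ('a, 'b) chart = "'a set \<times> ('a \<Rightarrow> 'b)"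

abbreviation cdom :: "('a, 'b) chart \<Rightarrow> 'a set" where "cdom c \<equiv> fst c"

abbreviation coord :: "('a, 'b) chart \<Rightarrow> 'a \<Rightarrow> 'b" where "coord c \<equiv> snd c"

abbreviation cimg :: "('a, 'b) chart \<Rightarrow> 'b set" where "cimg c \<equiv> coord c ` cdom c"

definition cinv :: "('a, 'b) chart \<Rightarrow> 'b \<Rightarrow> 'a" where
  "cinv c = inv_into (cdom c) (coord c)"

definition is_chart :: "('a::topological_space, 'b::euclidean_space) chart \<Rightarrow> bool" where
  "is_chart c \<longleftrightarrow> open (cdom c) \<and> open (cimg c) \<and>
     homeomorphism (cdom c) (cimg c) (coord c) (cinv c)"

definition compatible_charts ::
    "('a, 'b::euclidean_space) chart \<Rightarrow> ('a, 'b) chart \<Rightarrow> bool" where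
  "compatible_charts c d \<longleftrightarrow>
     smooth_on (coord c ` (cdom c \<inter> cdom d)) (coord d \<circ> cinv c) \<and>
     smooth_on (coord d ` (cdom c \<inter> cdom d)) (coord c \<circ> cinv d)"

definition smooth_structure ::
    "('a::topological_space, 'b::euclidean_space) chart set \<Rightarrow> bool" where
  "smooth_structure A \<longleftrightarrow>
     (\<forall>c\<in>A. is_chart c) \<and> (\<Union>c\<in>A. cdom c) = UNIV \<and>
     (\<forall>c\<in>A. \<forall>d\<in>A. compatible_charts c d) \<and>
     (\<forall>c. is_chart c \<and> (\<forall>d\<in>A. compatible_charts c d) \<longrightarrow> c \<in> A)"

definition smooth_fun ::
    "('a, 'b::euclidean_space) chart set \<Rightarrow> ('a \<Rightarrow> 'c::real_normed_vector) \<Rightarrow> bool" where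
  "smooth_fun A f \<longleftrightarrow> (\<forall>c\<in>A. smooth_on (cimg c) (f \<circ> cinv c))"

definition dfun ::
    "('a, 'b::euclidean_space) chart \<Rightarrow> ('a \<Rightarrow> 'c::real_normed_vector) \<Rightarrow> 'a \<Rightarrow> 'b \<Rightarrow> 'c" where
  "dfun c f p = frechet_derivative (f \<circ> cinv c) (at (coord c p))"

text \<open>The differential at \<^term>\<open>p\<close> of a map of the manifold to itself, from the chart \<^term>\<open>c\<close>
  around \<^term>\<open>p\<close> to the chart \<^term>\<open>d\<close> around \<^term>\<open>f p\<close>; for \<^term>\<open>f = id\<close> it
  is the Jacobian of the change of coordinates.\<close>

definition dmap ::
    "('a, 'b::euclidean_space) chart \<Rightarrow> ('a, 'b) chart \<Rightarrow> ('a \<Rightarrow> 'a) \<Rightarrow> 'a \<Rightarrow> 'b \<Rightarrow> 'b" where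
  "dmap c d f p = dfun c (coord d \<circ> f) p"

section \<open>Tensor fields\<close>

text \<open>A tensor field is given by its coordinate expression \<^term>\<open>T c p\<close> in every chart \<^term>\<open>c\<close>
  at every point \<^term>\<open>p \<in> cdom c\<close>, subject to the transformation law (invariance under \<^term>\<open>id\<close>
  in the sense below).  In a chart, a tangent vector is an element of the model space \<^typ>\<open>'b\<close>.
  Values for non-charts or outside the domain are irrelevant.\<close>

type_synonym ('a, 'b) vfield = "('a, 'b) chart \<Rightarrow> 'a \<Rightarrow> 'b"
type_synonym ('a, 'b) endo = "('a, 'b) chart \<Rightarrow> 'a \<Rightarrow> 'b \<Rightarrow> 'b"
type_synonym ('a, 'b) form2 = "('a, 'b) chart \<Rightarrow> 'a \<Rightarrow> 'b \<Rightarrow> 'b \<Rightarrow> real"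

definition endo_invariant ::
    "('a, 'b::euclidean_space) chart set \<Rightarrow> ('a \<Rightarrow> 'a) \<Rightarrow> ('a, 'b) endo \<Rightarrow> bool" where
  "endo_invariant A f J \<longleftrightarrow>
     (\<forall>c\<in>A. \<forall>d\<in>A. \<forall>p\<in>cdom c. f p \<in> cdom d \<longrightarrow>
        (\<forall>v. J d (f p) (dmap c d f p v) = dmap c d f p (J c p v)))"

definition form2_invariant ::
    "('a, 'b::euclidean_space) chart set \<Rightarrow> ('a \<Rightarrow> 'a) \<Rightarrow> ('a, 'b) form2 \<Rightarrow> bool" where
  "form2_invariant A f \<Omega> \<longleftrightarrow>
     (\<forall>c\<in>A. \<forall>d\<in>A. \<forall>p\<in>cdom c. f p \<in> cdom d \<longrightarrow>
        (\<forall>u v. \<Omega> d (f p) (dmap c d f p u) (dmap c d f p v) = \<Omega> c p u v))"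

definition endo_field ::
    "('a, 'b::euclidean_space) chart set \<Rightarrow> ('a, 'b) endo \<Rightarrow> bool" where
  "endo_field A J \<longleftrightarrow>
     (\<forall>c\<in>A. \<forall>p\<in>cdom c. linear (J c p)) \<and>
     (\<forall>c\<in>A. \<forall>v. smooth_on (cimg c) (\<lambda>y. J c (cinv c y) v)) \<and>
     endo_invariant A id J"

definition two_form ::
    "('a, 'b::euclidean_space) chart set \<Rightarrow> ('a, 'b) form2 \<Rightarrow> bool" where
  "two_form A \<Omega> \<longleftrightarrow>
     (\<forall>c\<in>A. \<forall>p\<in>cdom c. bilinear (\<Omega> c p) \<and> (\<forall>v. \<Omega> c p v v = 0)) \<and>
     (\<forall>c\<in>A. \<forall>u v. smooth_on (cimg c) (\<lambda>y. \<Omega> c (cinv c y) u v)) \<and>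
     form2_invariant A id \<Omega>"

text \<open>The components of the exterior derivative in a chart: coordinate fields commute, so only the
  three differentiated terms remain.\<close>

definition closed_form2 ::
    "('a, 'b::euclidean_space) chart set \<Rightarrow> ('a, 'b) form2 \<Rightarrow> bool" where
  "closed_form2 A \<Omega> \<longleftrightarrow>
     (\<forall>c\<in>A. \<forall>p\<in>cdom c. \<forall>u v w.
        dfun c (\<lambda>q. \<Omega> c q v w) p u + dfun c (\<lambda>q. \<Omega> c q w u) p v + dfun c (\<lambda>q. \<Omega> c q u v) p w = 0)"

definition symplectic_form ::
    "('a, 'b::euclidean_space) chart set \<Rightarrow> ('a, 'b) form2 \<Rightarrow> bool" where
  "symplectic_form A \<Omega> \<longleftrightarrow> two_form A \<Omega> \<and> closed_form2 A \<Omega> \<and>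
     (\<forall>c\<in>A. \<forall>p\<in>cdom c. \<forall>u. (\<forall>v. \<Omega> c p u v = 0) \<longrightarrow> u = 0)"

section \<open>Integrable complex structures\<close>

definition lie_bracket ::
    "('b::euclidean_space \<Rightarrow> 'b) \<Rightarrow> ('b \<Rightarrow> 'b) \<Rightarrow> 'b \<Rightarrow> 'b" where
  "lie_bracket X Y y =
     frechet_derivative Y (at y) (X y) - frechet_derivative X (at y) (Y y)"

definition nijenhuis ::
    "('b::euclidean_space \<Rightarrow> 'b \<Rightarrow> 'b) \<Rightarrow> ('b \<Rightarrow> 'b) \<Rightarrow> ('b \<Rightarrow> 'b) \<Rightarrow> 'b \<Rightarrow> 'b" where
  "nijenhuis J X Y y =
     lie_bracket (\<lambda>z. J z (X z)) (\<lambda>z. J z (Y z)) y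
     - J y (lie_bracket (\<lambda>z. J z (X z)) Y y)
     - J y (lie_bracket X (\<lambda>z. J z (Y z)) y)
     - lie_bracket X Y y"

text \<open>Integrability is the vanishing of the Nijenhuis tensor on all local smooth vector fields.\<close>

definition complex_structure ::
    "('a, 'b::euclidean_space) chart set \<Rightarrow> ('a, 'b) endo \<Rightarrow> bool" where
  "complex_structure A J \<longleftrightarrow> endo_field A J \<and>
     (\<forall>c\<in>A. \<forall>p\<in>cdom c. \<forall>v. J c p (J c p v) = - v) \<and>
     (\<forall>c\<in>A. \<forall>X Y. smooth_on (cimg c) X \<and> smooth_on (cimg c) Y \<longrightarrow>
        (\<forall>y\<in>cimg c. nijenhuis (\<lambda>z. J c (cinv c z)) X Y y = 0))"

section \<open>Toric symplectic manifolds\<close>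

text \<open>The torus is the group of vectors of unit complex numbers under componentwise
  multiplication, with Lie algebra \<^typ>\<open>real ^ 'n\<close>.\<close>

definition torus :: "(complex ^ 'n) set" where
  "torus = {z. \<forall>i. norm (z $ i) = 1}"

definition texp :: "real ^ 'n \<Rightarrow> complex ^ 'n" where
  "texp \<xi> = (\<chi> i. cis (\<xi> $ i))"

text \<open>As \<^const>\<open>texp\<close> is a surjective local diffeomorphism onto the torus, smoothness of
  \<^term>\<open>\<lambda>(z, p). a z p\<close> is expressed by composing with it.\<close>

definition smooth_torus_action ::
    "('a::topological_space, 'b::euclidean_space) chart set \<Rightarrow> (complex ^ 'n \<Rightarrow> 'a \<Rightarrow> 'a) \<Rightarrow> bool" where
  "smooth_torus_action A a \<longleftrightarrow>
     (\<forall>p. a 1 p = p) \<and>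
     (\<forall>z\<in>torus. \<forall>w\<in>torus. \<forall>p. a (z * w) p = a z (a w p)) \<and>
     continuous_on (torus \<times> UNIV) (\<lambda>(z, p). a z p) \<and>
     (\<forall>c\<in>A. \<forall>d\<in>A. smooth_on
        {(\<xi>, y). y \<in> cimg c \<and> a (texp \<xi>) (cinv c y) \<in> cdom d}
        (\<lambda>(\<xi>, y). coord d (a (texp \<xi>) (cinv c y))))"

definition effective_action :: "(complex ^ 'n \<Rightarrow> 'a \<Rightarrow> 'a) \<Rightarrow> bool" where
  "effective_action a \<longleftrightarrow> (\<forall>z\<in>torus. (\<forall>p. a z p = p) \<longrightarrow> z = 1)"

definition fund_field ::
    "(complex ^ 'n \<Rightarrow> 'a \<Rightarrow> 'a) \<Rightarrow> real ^ 'n \<Rightarrow> ('a, 'b::euclidean_space) vfield" where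
  "fund_field a \<xi> c p = vector_derivative (\<lambda>s. coord c (a (texp (s *\<^sub>R \<xi>)) p)) (at 0)"

definition lie_basis :: "('n::finite \<Rightarrow> real ^ 'n) \<Rightarrow> bool" where
  "lie_basis e \<longleftrightarrow> inj e \<and> independent (range e) \<and> span (range e) = UNIV"

text \<open>The dual of the Lie algebra is identified with \<^typ>\<open>real ^ 'n\<close> by the basis dual to
  \<^term>\<open>e\<close>, so that \<^term>\<open>\<mu> p $ j\<close> is the component of the moment map along \<^term>\<open>e j\<close>.\<close>

definition moment_map ::
    "('a, 'b::euclidean_space) chart set \<Rightarrow> ('a, 'b) form2 \<Rightarrow> (complex ^ 'n \<Rightarrow> 'a \<Rightarrow> 'a) \<Rightarrow>
     ('n::finite \<Rightarrow> real ^ 'n) \<Rightarrow> ('a \<Rightarrow> real ^ 'n) \<Rightarrow> bool" where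
  "moment_map A \<Omega> a e \<mu> \<longleftrightarrow>
     smooth_fun A \<mu> \<and>
     (\<forall>z\<in>torus. \<forall>p. \<mu> (a z p) = \<mu> p) \<and>
     (\<forall>c\<in>A. \<forall>p\<in>cdom c. \<forall>j v.
        \<Omega> c p (fund_field a (e j) c p) v = - dfun c (\<lambda>q. \<mu> q $ j) p v)"

text \<open>The model space of dimension \<^term>\<open>2 * CARD('n)\<close>.\<close>

type_synonym 'n model = "(real ^ 'n) \<times> (real ^ 'n)"

definition toric_symplectic_manifold ::
    "('a::{t2_space,second_countable_topology}, 'n::finite model) chart set \<Rightarrow>
     ('a, 'n model) form2 \<Rightarrow> (complex ^ 'n \<Rightarrow> 'a \<Rightarrow> 'a) \<Rightarrow>
     ('n \<Rightarrow> real ^ 'n) \<Rightarrow> ('a \<Rightarrow> real ^ 'n) \<Rightarrow> bool" where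
  "toric_symplectic_manifold A \<Omega> a e \<mu> \<longleftrightarrow>
     compact (UNIV :: 'a set) \<and> connected (UNIV :: 'a set) \<and>
     smooth_structure A \<and> symplectic_form A \<Omega> \<and>
     smooth_torus_action A a \<and> effective_action a \<and>
     (\<forall>z\<in>torus. form2_invariant A (a z) \<Omega>) \<and>
     lie_basis e \<and> moment_map A \<Omega> a e \<mu>"

definition moment_polytope :: "('a \<Rightarrow> real ^ 'n) \<Rightarrow> (real ^ 'n) set" where
  "moment_polytope \<mu> = range \<mu>"

definition open_part :: "('a \<Rightarrow> real ^ 'n) \<Rightarrow> 'a set" where
  "open_part \<mu> = \<mu> -` interior (moment_polytope \<mu>)"

section \<open>Toric generalized Kaehler structures\<close>

definition tamed ::
    "('a, 'b::euclidean_space) chart set \<Rightarrow> ('a, 'b) form2 \<Rightarrow> ('a, 'b) endo \<Rightarrow> bool" where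
  "tamed A \<Omega> J \<longleftrightarrow> (\<forall>c\<in>A. \<forall>p\<in>cdom c. \<forall>v. v \<noteq> 0 \<longrightarrow> \<Omega> c p v (J c p v) > 0)"

text \<open>The endomorphism that composes the inverse of \<^term>\<open>\<Omega>\<close>, the dual of \<^term>\<open>J\<close> and
  \<^term>\<open>\<Omega>\<close>, with a minus sign.  A 2-form sends a vector to its contraction with the form, and the
  dual of \<^term>\<open>J\<close> is precomposition with \<^term>\<open>J\<close>; so the value at \<^term>\<open>u\<close> is the
  vector \<^term>\<open>w\<close>, unique by nondegeneracy, whose contraction is minus that of \<^term>\<open>u\<close>
  precomposed with \<^term>\<open>J\<close>.\<close>

definition minus_structure ::
    "('a, 'b::euclidean_space) form2 \<Rightarrow> ('a, 'b) endo \<Rightarrow> ('a, 'b) endo" where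
  "minus_structure \<Omega> J c p u = (THE w. \<forall>v. \<Omega> c p w v = - \<Omega> c p u (J c p v))"

definition GK ::
    "('a, 'b::euclidean_space) chart set \<Rightarrow> ('a, 'b) form2 \<Rightarrow> (complex ^ 'n \<Rightarrow> 'a \<Rightarrow> 'a) \<Rightarrow>
     ('a, 'b) endo set" where
  "GK A \<Omega> a = {J. complex_structure A J \<and> (\<forall>z\<in>torus. endo_invariant A (a z) J) \<and>
     tamed A \<Omega> J \<and> complex_structure A (minus_structure \<Omega> J)}"

definition DGK ::
    "('a, 'b::euclidean_space) chart set \<Rightarrow> ('a, 'b) form2 \<Rightarrow> (complex ^ 'n \<Rightarrow> 'a \<Rightarrow> 'a) \<Rightarrow>
     ('n::finite \<Rightarrow> real ^ 'n) \<Rightarrow> ('a \<Rightarrow> real ^ 'n) \<Rightarrow> ('a, 'b) endo set" where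
  "DGK A \<Omega> a e \<mu> = {J \<in> GK A \<Omega> a. \<forall>c\<in>A. \<forall>p\<in>cdom c \<inter> open_part \<mu>.
     J c p ` span (range (\<lambda>j. fund_field a (e j) c p)) =
     minus_structure \<Omega> J c p ` span (range (\<lambda>j. fund_field a (e j) c p))}"

definition toric_Kaehler ::
    "('a, 'b::euclidean_space) chart set \<Rightarrow> ('a, 'b) form2 \<Rightarrow> (complex ^ 'n \<Rightarrow> 'a \<Rightarrow> 'a) \<Rightarrow>
     ('a, 'b) endo set" where
  "toric_Kaehler A \<Omega> a = {I. complex_structure A I \<and> (\<forall>z\<in>torus. endo_invariant A (a z) I) \<and>
     tamed A \<Omega> I \<and>
     (\<forall>c\<in>A. \<forall>p\<in>cdom c. \<forall>u v. \<Omega> c p (I c p u) (I c p v) = \<Omega> c p u v)}"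

section \<open>Admissible coordinates and symplectic potentials\<close>

text \<open>The coordinates of an admissible chart are \<^term>\<open>(\<theta>, \<mu>)\<close>.  A tangent vector \<^term>\<open>v\<close> read in
  the chart \<^term>\<open>c\<close> has \<^term>\<open>fst v $ j\<close> as its \<^term>\<open>d\<theta> j\<close> component; hence the last
  clause says that the \<^term>\<open>d\<theta> j\<close> are the first half of the coframe dual to the
  frame of the fields \<^term>\<open>X j\<close>, \<^term>\<open>I (X j)\<close>.  On a compact toric manifold these charts cover
  \<^term>\<open>open_part \<mu>\<close>: there the frame exists and this half of the dual coframe is closed.\<close>

definition admissible_chart ::
    "('a, 'n::finite model) chart set \<Rightarrow> (complex ^ 'n \<Rightarrow> 'a \<Rightarrow> 'a) \<Rightarrow> ('n \<Rightarrow> real ^ 'n) \<Rightarrow>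
     ('a \<Rightarrow> real ^ 'n) \<Rightarrow> ('a, 'n model) endo \<Rightarrow> ('a, 'n model) chart \<Rightarrow> bool" where
  "admissible_chart A a e \<mu> I c \<longleftrightarrow>
     c \<in> A \<and> cdom c \<subseteq> open_part \<mu> \<and>
     (\<forall>p\<in>cdom c. snd (coord c p) = \<mu> p) \<and>
     (\<forall>p\<in>cdom c. \<forall>k. fst (fund_field a (e k) c p) = axis k 1 \<and>
        fst (I c p (fund_field a (e k) c p)) = 0)"

definition del_theta :: "'n \<Rightarrow> 'n::finite model" where
  "del_theta j = (axis j 1, 0)"

definition del_mu :: "'n \<Rightarrow> 'n::finite model" where
  "del_mu j = (0, axis j 1)"

definition Hess :: "(real ^ 'n \<Rightarrow> real) \<Rightarrow> real ^ 'n \<Rightarrow> real ^ 'n ^ 'n" where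
  "Hess f x = (\<chi> k j.
     frechet_derivative (\<lambda>y. frechet_derivative f (at y) (axis j 1)) (at x) (axis k 1))"

definition symplectic_potential ::
    "('a, 'n::finite model) chart set \<Rightarrow> (complex ^ 'n \<Rightarrow> 'a \<Rightarrow> 'a) \<Rightarrow> ('n \<Rightarrow> real ^ 'n) \<Rightarrow>
     ('a \<Rightarrow> real ^ 'n) \<Rightarrow> ('a, 'n model) endo \<Rightarrow> (real ^ 'n \<Rightarrow> real) \<Rightarrow> bool" where
  "symplectic_potential A a e \<mu> I \<tau> \<longleftrightarrow>
     smooth_on (interior (moment_polytope \<mu>)) \<tau> \<and>
     (\<forall>c. admissible_chart A a e \<mu> I c \<longrightarrow> (\<forall>p\<in>cdom c. \<forall>k.
        I c p (del_mu k) = (\<Sum>j\<in>UNIV. Hess \<tau> (\<mu> p) $ k $ j *\<^sub>R del_theta j)))"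

end

theory Submission
  imports Defs
begin

text \<open>Put \<open>N = \<Sum>\<^sub>k\<^sub>j C\<^sub>k\<^sub>j d\<mu>\<^sub>k \<otimes> X\<^sub>j\<close>, a globally defined field of endomorphisms with \<open>N N = 0\<close> that is
  self-adjoint for \<open>\<Omega>\<close>.  In admissible coordinates the required structure is \<open>J = B\<^sup>-\<^sup>1 I B\<close> with
  \<open>B = 1 - I N\<close>, equivalently \<open>J - I N J = I + N\<close>; this makes sense on the whole manifold because
  \<open>B v = 0\<close> gives \<open>v = I N v\<close>, so that \<open>\<Omega> (N v) (I N v) = \<Omega> (N v) v = 0\<close> and \<open>N v = 0\<close>.
  No behaviour at the boundary of the polytope has to be studied.

  Taming follows from \<open>\<Omega> v (J v) = g(w, w)\<close> with \<open>w = v + N J v\<close> and the metric \<open>g\<close> of \<open>I\<close>; the second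
  structure \<open>-\<Omega>\<^sup>-\<^sup>1 J\<^sup>* \<Omega>\<close> belongs to \<open>- C\<close>, and both structures map the span of the \<open>X\<^sub>j\<close> onto its image
  under \<open>I\<close>.  For integrability, conjugating the Nijenhuis tensor of \<open>J\<close> by \<open>B\<close> leaves only terms that
  cancel because the fields \<open>I \<Sum>\<^sub>j C\<^sub>k\<^sub>j X\<^sub>j\<close> are holomorphic and commute and the second derivatives of
  the \<open>\<mu>\<^sub>k\<close> are symmetric.\<close>

subsection \<open>Calculus of smooth maps\<close>

abbreviation D :: "('b::real_normed_vector \<Rightarrow> 'c::real_normed_vector) \<Rightarrow> 'b \<Rightarrow> 'b \<Rightarrow> 'c" where
  "D f x \<equiv> frechet_derivative f (at x)"

lemma has_derivative_D: "f differentiable (at x) \<Longrightarrow> (f has_derivative D f x) (at x)"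
  using frechet_derivative_works by blast

lemma D_eqI: "(f has_derivative f') (at x) \<Longrightarrow> D f x = f'"
  using frechet_derivative_at by metis

text \<open>\<open>frechet_derivative\<close> chooses among all derivatives, and locally equal maps
  have the same ones; so the equality also covers maps without a derivative at
  \<open>x\<close>.\<close>

lemma D_cong:
  assumes "open S" "x \<in> S" "\<And>z. z \<in> S \<Longrightarrow> f z = g z"
  shows "D f x = D g x"
proof -
  have "(f has_derivative f') (at x) \<longleftrightarrow> (g has_derivative f') (at x)" for f'
    using has_derivative_transform_within_open[of f f' x UNIV S g]
      has_derivative_transform_within_open[of g f' x UNIV S f] assms by auto
  then show ?thesis
    unfolding frechet_derivative_def by simp
qed

lemma differentiable_cong_open:
  assumes "open S" "x \<in> S" "\<And>z. z \<in> S \<Longrightarrow> f z = g z" "f differentiable (at x)"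
  shows "g differentiable (at x)"
  using assms has_derivative_transform_within_open[of f _ x UNIV S g]
  unfolding differentiable_def by blast

lemma Ck_on_cong:
  assumes "open S" "\<And>x. x \<in> S \<Longrightarrow> f x = g x" "Ck_on k f S"
  shows "Ck_on k g S"
  using assms(2,3)
proof (induction k arbitrary: f g)
  case 0
  then show ?case by (simp cong: continuous_on_cong)
next
  case (Suc k)
  have "Ck_on k (\<lambda>x. D g x v) S" for v
  proof (rule Suc.IH)
    show "D f x v = D g x v" if "x \<in> S" for x
      using D_cong[OF assms(1) that, of f g] Suc.prems(1) by simp
  qed (use Suc.prems in simp)
  with Suc.prems show ?case
    using differentiable_cong_open[OF assms(1), of _ f g] by auto
qed

lemma Ck_on_Suc_imp: "Ck_on (Suc k) f S \<Longrightarrow> Ck_on k f S"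
proof (induction k arbitrary: f)
  case 0
  then show ?case
    by (auto intro!: continuous_at_imp_continuous_on differentiable_imp_continuous_within)
next
  case (Suc k)
  then show ?case by (metis Ck_on.simps(2))
qed

lemma smooth_on_differentiable: "smooth_on S f \<Longrightarrow> x \<in> S \<Longrightarrow> f differentiable (at x)"
  unfolding smooth_on_def by (metis Ck_on.simps(2))

lemma smooth_on_D: "smooth_on S f \<Longrightarrow> smooth_on S (\<lambda>x. D f x v)"
  unfolding smooth_on_def by (metis Ck_on.simps(2))

lemma smooth_on_cong:
  assumes "open S" "\<And>x. x \<in> S \<Longrightarrow> f x = g x" "smooth_on S f"
  shows "smooth_on S g"
  using assms Ck_on_cong unfolding smooth_on_def by metis

lemma Ck_on_const [simp]: "Ck_on k (\<lambda>x. c) S"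
  by (induction k arbitrary: c) auto

lemma smooth_on_const [simp]: "smooth_on S (\<lambda>x. c)"
  by (simp add: smooth_on_def)

lemma Ck_on_add:
  assumes "open S" "Ck_on k f S" "Ck_on k g S"
  shows "Ck_on k (\<lambda>x. f x + g x) S"
  using assms(2,3)
proof (induction k arbitrary: f g)
  case 0
  then show ?case by (simp add: continuous_on_add)
next
  case (Suc k)
  have "Ck_on k (\<lambda>x. D (\<lambda>x. f x + g x) x v) S" for v
  proof (rule Ck_on_cong[OF assms(1)])
    show "Ck_on k (\<lambda>x. D f x v + D g x v) S"
      using Suc by simp
    show "D f x v + D g x v = D (\<lambda>x. f x + g x) x v" if "x \<in> S" for x
    proof -
      have "f differentiable at x" "g differentiable at x"
        using Suc.prems that by auto
      then show ?thesis
        by (subst D_eqI[OF has_derivative_add[OF has_derivative_D has_derivative_D]]) auto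
    qed
  qed
  with Suc.prems show ?case by (auto intro!: differentiable_add)
qed

lemma Ck_on_linear:
  assumes "open S" "bounded_linear h" "Ck_on k f S"
  shows "Ck_on k (\<lambda>x. h (f x)) S"
  using assms(3)
proof (induction k arbitrary: f)
  case 0
  then show ?case using assms(2) by (simp add: bounded_linear.continuous_on)
next
  case (Suc k)
  have der: "((\<lambda>x. h (f x)) has_derivative (\<lambda>v. h (D f x v))) (at x)" if "x \<in> S" for x
    using Suc.prems that by (intro bounded_linear.has_derivative[OF assms(2)] has_derivative_D) simp
  have "Ck_on k (\<lambda>x. D (\<lambda>x. h (f x)) x v) S" for v
  proof (rule Ck_on_cong[OF assms(1)])
    show "Ck_on k (\<lambda>x. h (D f x v)) S"
      using Suc by simp
    show "h (D f x v) = D (\<lambda>x. h (f x)) x v" if "x \<in> S" for x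
      using D_eqI[OF der[OF that]] by simp
  qed
  with der show ?case by (auto simp: differentiable_def)
qed

lemma Ck_on_bilinear:
  assumes "open S" "bounded_bilinear h" "Ck_on k f S" "Ck_on k g S"
  shows "Ck_on k (\<lambda>x. h (f x) (g x)) S"
  using assms(3,4)
proof (induction k arbitrary: f g)
  case 0
  then show ?case using assms(2) by (simp add: bounded_bilinear.continuous_on)
next
  case (Suc k)
  have der: "((\<lambda>x. h (f x) (g x)) has_derivative (\<lambda>v. h (f x) (D g x v) + h (D f x v) (g x))) (at x)"
    if "x \<in> S" for x
    using Suc.prems that by (intro bounded_bilinear.FDERIV[OF assms(2)] has_derivative_D) auto
  have "Ck_on k (\<lambda>x. D (\<lambda>x. h (f x) (g x)) x v) S" for v
  proof (rule Ck_on_cong[OF assms(1)])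
    \<comment> \<open>Each Leibniz term keeps one undifferentiated factor, whose order is lowered
      from \<open>Suc k\<close> to \<open>k\<close> before the induction hypothesis applies.\<close>
    show "Ck_on k (\<lambda>x. h (f x) (D g x v) + h (D f x v) (g x)) S"
      using Suc.prems Ck_on_Suc_imp[OF Suc.prems(1)] Ck_on_Suc_imp[OF Suc.prems(2)]
      by (intro Ck_on_add[OF assms(1)] Suc.IH) auto
    show "h (f x) (D g x v) + h (D f x v) (g x) = D (\<lambda>x. h (f x) (g x)) x v" if "x \<in> S" for x
      using D_eqI[OF der[OF that]] by simp
  qed
  with der show ?case by (auto simp: differentiable_def)
qed

lemma Ck_on_sum:
  assumes "open S" "\<And>i. i \<in> T \<Longrightarrow> Ck_on k (f i) S"
  shows "Ck_on k (\<lambda>x. \<Sum>i\<in>T. f i x) S"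
  using assms by (induction T rule: infinite_finite_induct) (auto intro: Ck_on_add)

lemma smooth_on_add:
  "open S \<Longrightarrow> smooth_on S f \<Longrightarrow> smooth_on S g \<Longrightarrow> smooth_on S (\<lambda>x. f x + g x)"
  by (simp add: smooth_on_def Ck_on_add)

lemma smooth_on_linear:
  "open S \<Longrightarrow> bounded_linear h \<Longrightarrow> smooth_on S f \<Longrightarrow> smooth_on S (\<lambda>x. h (f x))"
  by (simp add: smooth_on_def Ck_on_linear)

lemma smooth_on_minus: "open S \<Longrightarrow> smooth_on S f \<Longrightarrow> smooth_on S (\<lambda>x. - f x)"
  by (rule smooth_on_linear[OF _ bounded_linear_minus[OF bounded_linear_ident]])

lemma smooth_on_diff:
  "open S \<Longrightarrow> smooth_on S f \<Longrightarrow> smooth_on S g \<Longrightarrow> smooth_on S (\<lambda>x. f x - g x)"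
  using smooth_on_add[of S f "\<lambda>x. - g x"] smooth_on_minus[of S g] by simp

lemma smooth_on_scaleR:
  "open S \<Longrightarrow> smooth_on S f \<Longrightarrow> smooth_on S g \<Longrightarrow> smooth_on S (\<lambda>x. f x *\<^sub>R g x)"
  by (simp add: smooth_on_def Ck_on_bilinear[OF _ bounded_bilinear_scaleR])

lemma smooth_on_sum:
  "open S \<Longrightarrow> (\<And>i. i \<in> T \<Longrightarrow> smooth_on S (f i)) \<Longrightarrow> smooth_on S (\<lambda>x. \<Sum>i\<in>T. f i x)"
  by (simp add: smooth_on_def Ck_on_sum)

subsection \<open>Symmetry of second derivatives\<close>

text \<open>The second difference is the increment of a first difference. The mean value theorem,
  used first in the direction \<open>u\<close> and then, on the resulting increment of
  \<open>D f z u\<close>, in the direction \<open>v\<close>, leaves one mixed derivative at a nearby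
  point.\<close>

lemma second_difference:
  fixes f :: "'b::real_normed_vector \<Rightarrow> real"
  assumes ball: "\<And>z. z \<in> ball x \<epsilon> \<Longrightarrow> f differentiable (at z)"
    "\<And>z. z \<in> ball x \<epsilon> \<Longrightarrow> (\<lambda>z. D f z u) differentiable (at z)"
    and t: "0 < t" "t * (norm u + norm v) < \<epsilon>"
  shows "\<exists>p\<in>ball x \<epsilon>. f (x + t *\<^sub>R u + t *\<^sub>R v) - f (x + t *\<^sub>R u) - f (x + t *\<^sub>R v) + f x
    = t * (t * D (\<lambda>z. D f z u) p v)"
proof -
  have mem: "x + s *\<^sub>R u + r *\<^sub>R v \<in> ball x \<epsilon>" if "0 \<le> s" "s \<le> t" "0 \<le> r" "r \<le> t" for s r
  proof -
    have "norm (s *\<^sub>R u + r *\<^sub>R v) \<le> s * norm u + r * norm v"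
      using that norm_triangle_ineq[of "s *\<^sub>R u" "r *\<^sub>R v"] by simp
    also have "\<dots> \<le> t * norm u + t * norm v"
      using that by (intro add_mono mult_right_mono) auto
    finally have "norm (s *\<^sub>R u + r *\<^sub>R v) < \<epsilon>"
      using t by (simp add: distrib_left)
    moreover have "dist x (x + w) = norm w" for w
      by (simp add: dist_norm)
    ultimately show ?thesis
      by (simp only: mem_ball add.assoc)
  qed
  define \<phi> where "\<phi> s = f (x + s *\<^sub>R u + t *\<^sub>R v) - f (x + s *\<^sub>R u)" for s
  have "(\<phi> has_derivative (\<lambda>h. h * (D f (x + s *\<^sub>R u + t *\<^sub>R v) u - D f (x + s *\<^sub>R u) u))) (at s)"
    if s: "0 \<le> s" "s \<le> t" for s
  proof -
    have "((\<lambda>s. f (x + s *\<^sub>R u + r *\<^sub>R v)) has_derivative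
        (\<lambda>h. D f (x + s *\<^sub>R u + r *\<^sub>R v) (h *\<^sub>R u))) (at s)" if "0 \<le> r" "r \<le> t" for r
      by (rule has_derivative_compose[of "\<lambda>s. x + s *\<^sub>R u + r *\<^sub>R v" "\<lambda>h. h *\<^sub>R u"])
        (auto intro!: derivative_eq_intros has_derivative_D ball mem s that)
    from this[of t] this[of 0] t have "(\<phi> has_derivative
        (\<lambda>h. D f (x + s *\<^sub>R u + t *\<^sub>R v) (h *\<^sub>R u) - D f (x + s *\<^sub>R u) (h *\<^sub>R u))) (at s)"
      unfolding \<phi>_def by (auto intro!: has_derivative_diff)
    moreover have "linear (D f (x + s *\<^sub>R u + t *\<^sub>R v))" "linear (D f (x + s *\<^sub>R u))"
      using ball(1)[OF mem, of s t] ball(1)[OF mem, of s 0] s t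
      by (auto intro: linear_frechet_derivative)
    ultimately show ?thesis
      by (simp add: linear_cmul right_diff_distrib)
  qed
  then obtain s where s: "0 < s" "s < t"
      "\<phi> t - \<phi> 0 = t * (D f (x + s *\<^sub>R u + t *\<^sub>R v) u - D f (x + s *\<^sub>R u) u)"
    using mvt_simple[of 0 t \<phi> "\<lambda>s h. h * (D f (x + s *\<^sub>R u + t *\<^sub>R v) u - D f (x + s *\<^sub>R u) u)"] t
    by (auto simp: has_derivative_at_withinI)
  define \<kappa> where "\<kappa> r = D f (x + s *\<^sub>R u + r *\<^sub>R v) u" for r
  have "(\<kappa> has_derivative (\<lambda>h. h * D (\<lambda>z. D f z u) (x + s *\<^sub>R u + r *\<^sub>R v) v)) (at r)"
    if r: "0 \<le> r" "r \<le> t" for r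
  proof -
    have m: "x + s *\<^sub>R u + r *\<^sub>R v \<in> ball x \<epsilon>"
      using s r by (intro mem) auto
    have "(\<kappa> has_derivative (\<lambda>h. D (\<lambda>z. D f z u) (x + s *\<^sub>R u + r *\<^sub>R v) (h *\<^sub>R v))) (at r)"
      unfolding \<kappa>_def
      by (rule has_derivative_compose[of "\<lambda>r. x + s *\<^sub>R u + r *\<^sub>R v" "\<lambda>h. h *\<^sub>R v"])
        (auto intro!: derivative_eq_intros has_derivative_D ball m)
    then show ?thesis
      using linear_frechet_derivative[OF ball(2)[OF m]] by (simp add: linear_cmul)
  qed
  then obtain r where r: "0 < r" "r < t"
      "\<kappa> t - \<kappa> 0 = t * D (\<lambda>z. D f z u) (x + s *\<^sub>R u + r *\<^sub>R v) v"
    using mvt_simple[of 0 t \<kappa> "\<lambda>r h. h * D (\<lambda>z. D f z u) (x + s *\<^sub>R u + r *\<^sub>R v) v"] t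
    by (auto simp: has_derivative_at_withinI)
  have "f (x + t *\<^sub>R u + t *\<^sub>R v) - f (x + t *\<^sub>R u) - f (x + t *\<^sub>R v) + f x = \<phi> t - \<phi> 0"
    by (simp add: \<phi>_def)
  also have "\<dots> = t * (\<kappa> t - \<kappa> 0)"
    using s by (simp add: \<kappa>_def)
  finally show ?thesis
    using r mem[of s r] s by auto
qed

text \<open>The second difference is symmetric in \<open>u\<close> and \<open>v\<close>, so the two
  mixed derivatives agree at two points \<open>p\<close> and \<open>q\<close> that may differ but
  both lie near \<open>x\<close>. If they disagreed at \<open>x\<close>, continuity would keep each
  within half their distance, which excludes \<open>\<alpha> p = \<beta> q\<close>.\<close>

lemma second_derivative_symmetric_real:
  fixes f :: "'b::real_normed_vector \<Rightarrow> real"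
  assumes S: "open S" "x \<in> S" and f: "Ck_on 2 f S"
  shows "D (\<lambda>z. D f z u) x v = D (\<lambda>z. D f z v) x u"
proof (rule ccontr)
  define \<alpha> where "\<alpha> p = D (\<lambda>z. D f z u) p v" for p
  define \<beta> where "\<beta> p = D (\<lambda>z. D f z v) p u" for p
  assume "D (\<lambda>z. D f z u) x v \<noteq> D (\<lambda>z. D f z v) x u"
  then have \<delta>: "dist (\<alpha> x) (\<beta> x) / 2 > 0" (is "?\<delta> > 0")
    by (simp add: \<alpha>_def \<beta>_def)
  have f1: "f differentiable (at z)" "(\<lambda>z. D f z w) differentiable (at z)" if "z \<in> S" for z w
    using f that by (auto simp: numeral_2_eq_2)
  have "continuous_on S \<alpha>" "continuous_on S \<beta>"
    using f by (auto simp: numeral_2_eq_2 \<alpha>_def \<beta>_def)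
  then have cont: "isCont \<alpha> x" "isCont \<beta> x"
    using S by (auto simp: continuous_on_eq_continuous_at)
  obtain d1 where d1: "d1 > 0" "\<And>p. dist p x < d1 \<Longrightarrow> dist (\<alpha> p) (\<alpha> x) < ?\<delta>"
    using cont(1)[unfolded continuous_at_eps_delta, rule_format, OF \<delta>] by blast
  obtain d2 where d2: "d2 > 0" "\<And>p. dist p x < d2 \<Longrightarrow> dist (\<beta> p) (\<beta> x) < ?\<delta>"
    using cont(2)[unfolded continuous_at_eps_delta, rule_format, OF \<delta>] by blast
  note d = d1 d2
  obtain d3 where d3: "d3 > 0" "ball x d3 \<subseteq> S"
    using S open_contains_ball by blast
  define \<epsilon> where "\<epsilon> = Min {d1, d2, d3}"
  have \<epsilon>: "\<epsilon> > 0" "\<epsilon> \<le> d1" "\<epsilon> \<le> d2" "\<epsilon> \<le> d3"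
    using d d3 by (auto simp: \<epsilon>_def)
  \<comment> \<open>The summand 1 keeps the denominator positive when \<open>u\<close> and
    \<open>v\<close> vanish and makes the bound by \<epsilon> strict.\<close>
  define t where "t = \<epsilon> / (norm u + norm v + 1)"
  have pos: "norm u + norm v + 1 > 0"
    by (smt (verit) norm_ge_zero)
  have t: "t > 0" "t * (norm u + norm v) < \<epsilon>"
    using \<epsilon>(1) pos by (simp_all add: t_def field_simps)
  have b: "ball x \<epsilon> \<subseteq> S" using d3 \<epsilon> by auto
  obtain p where p: "p \<in> ball x \<epsilon>"
      "f (x + t *\<^sub>R u + t *\<^sub>R v) - f (x + t *\<^sub>R u) - f (x + t *\<^sub>R v) + f x = t * (t * \<alpha> p)"
    using second_difference[of x \<epsilon> f u t v, OF f1(1)[OF subsetD[OF b]] f1(2)[OF subsetD[OF b]] t]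
    unfolding \<alpha>_def by blast
  obtain q where q: "q \<in> ball x \<epsilon>"
      "f (x + t *\<^sub>R v + t *\<^sub>R u) - f (x + t *\<^sub>R v) - f (x + t *\<^sub>R u) + f x = t * (t * \<beta> q)"
    using second_difference[of x \<epsilon> f v t u, OF f1(1)[OF subsetD[OF b]] f1(2)[OF subsetD[OF b]] t(1)] t(2)
    unfolding \<beta>_def add.commute[of "norm v"] by blast
  have eq: "x + t *\<^sub>R v + t *\<^sub>R u = x + t *\<^sub>R u + t *\<^sub>R v"
    by (simp only: add.assoc add.commute[of "t *\<^sub>R v"])
  have "t * (t * \<alpha> p) = t * (t * \<beta> q)"
    using p(2) q(2) unfolding eq by linarith
  with t(1) have "\<alpha> p = \<beta> q"
    by (metis mult_left_cancel less_irrefl)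
  moreover have "dist (\<alpha> p) (\<alpha> x) < ?\<delta>" "dist (\<beta> q) (\<beta> x) < ?\<delta>"
    using p q \<epsilon> d by (auto simp: dist_commute)
  ultimately show False
    using dist_triangle[of "\<alpha> x" "\<beta> x" "\<alpha> p"] by (simp add: dist_commute)
qed

text \<open>Taking a component commutes with differentiation, which reduces the claim to real
  functions.\<close>

lemma second_derivative_symmetric:
  fixes f :: "'b::real_normed_vector \<Rightarrow> 'c::euclidean_space"
  assumes S: "open S" "x \<in> S" and f: "smooth_on S f"
  shows "D (\<lambda>z. D f z u) x v = D (\<lambda>z. D f z v) x u"
proof (rule euclidean_eqI)
  fix b :: 'c assume "b \<in> Basis"
  have bl: "bounded_linear (\<lambda>w. w \<bullet> b)"
    by (rule bounded_linear_inner_left)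
  have comp: "D (\<lambda>z. g z \<bullet> b) z w = D g z w \<bullet> b" if "smooth_on S g" "z \<in> S" for g z w
    using D_eqI[OF bounded_linear.has_derivative[OF bl has_derivative_D[OF
        smooth_on_differentiable[OF that]]]] by simp
  have "D (\<lambda>z. D f z w) x w' \<bullet> b = D (\<lambda>z. D (\<lambda>z. f z \<bullet> b) z w) x w'" for w w'
    using comp[OF smooth_on_D[OF f] S(2), of w w'] comp[OF f]
    using D_cong[OF S, of "\<lambda>z. D f z w \<bullet> b" "\<lambda>z. D (\<lambda>z. f z \<bullet> b) z w"] by metis
  moreover have "smooth_on S (\<lambda>z. f z \<bullet> b)"
    by (rule smooth_on_linear[OF S(1) bl f])
  ultimately show "D (\<lambda>z. D f z u) x v \<bullet> b = D (\<lambda>z. D f z v) x u \<bullet> b"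
    using second_derivative_symmetric_real[OF S] by (simp add: smooth_on_def)
qed

subsection \<open>Smooth families of linear maps\<close>

lemma linear_basis_expansion:
  fixes L :: "'b::euclidean_space \<Rightarrow> 'c::real_vector"
  assumes "linear L"
  shows "L x = (\<Sum>b\<in>Basis. (x \<bullet> b) *\<^sub>R L b)"
proof -
  have "L x = L (\<Sum>b\<in>Basis. (x \<bullet> b) *\<^sub>R b)"
    by (simp add: euclidean_representation)
  also have "\<dots> = (\<Sum>b\<in>Basis. (x \<bullet> b) *\<^sub>R L b)"
    using assms by (simp add: linear_sum linear_cmul)
  finally show ?thesis .
qed

lemma smooth_on_apply:
  fixes L :: "'a::real_normed_vector \<Rightarrow> 'b::euclidean_space \<Rightarrow> 'c::real_normed_vector"
  assumes "open S" "\<And>y. y \<in> S \<Longrightarrow> linear (L y)" "\<And>v. smooth_on S (\<lambda>y. L y v)" "smooth_on S X"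
  shows "smooth_on S (\<lambda>y. L y (X y))"
proof (rule smooth_on_cong[OF assms(1)])
  show "smooth_on S (\<lambda>y. \<Sum>b\<in>Basis. (X y \<bullet> b) *\<^sub>R L y b)"
    by (intro smooth_on_sum smooth_on_scaleR assms smooth_on_linear[OF _ bounded_linear_inner_left])
  show "(\<Sum>b\<in>Basis. (X y \<bullet> b) *\<^sub>R L y b) = L y (X y)" if "y \<in> S" for y
    using linear_basis_expansion[OF assms(2)[OF that], of "X y"] by simp
qed

lemma linear_D_field:
  fixes L :: "'a::real_normed_vector \<Rightarrow> 'b::euclidean_space \<Rightarrow> 'c::real_normed_vector"
  assumes S: "open S" "y \<in> S" and lin: "\<And>z. z \<in> S \<Longrightarrow> linear (L z)"
    and diff: "\<And>v. (\<lambda>z. L z v) differentiable (at y)"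
  shows "linear (\<lambda>v. D (\<lambda>z. L z v) y u)"
proof (rule linearI)
  fix v w :: 'b and r :: real
  have "D (\<lambda>z. L z (v + w)) y = D (\<lambda>z. L z v + L z w) y"
    by (rule D_cong[OF S]) (use lin linear_add in blast)
  also have "\<dots> = (\<lambda>u. D (\<lambda>z. L z v) y u + D (\<lambda>z. L z w) y u)"
    by (intro D_eqI has_derivative_add has_derivative_D diff)
  finally show "D (\<lambda>z. L z (v + w)) y u = D (\<lambda>z. L z v) y u + D (\<lambda>z. L z w) y u"
    by simp
  have "D (\<lambda>z. L z (r *\<^sub>R v)) y = D (\<lambda>z. r *\<^sub>R L z v) y"
    by (rule D_cong[OF S]) (use lin linear_cmul in blast)
  also have "\<dots> = (\<lambda>u. r *\<^sub>R D (\<lambda>z. L z v) y u)"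
    by (intro D_eqI has_derivative_scaleR_right has_derivative_D diff)
  finally show "D (\<lambda>z. L z (r *\<^sub>R v)) y u = r *\<^sub>R D (\<lambda>z. L z v) y u"
    by simp
qed

text \<open>Differentiability of the family is given for each fixed vector only, so
  \<open>X z\<close> is expanded in the finite basis and the ordinary product rule used;
  \<open>linear_D_field\<close> reassembles the sum.\<close>

lemma has_derivative_apply:
  fixes L :: "'a::real_normed_vector \<Rightarrow> 'b::euclidean_space \<Rightarrow> 'c::real_normed_vector"
  assumes S: "open S" "y \<in> S" and lin: "\<And>z. z \<in> S \<Longrightarrow> linear (L z)"
    and diff: "\<And>v. (\<lambda>z. L z v) differentiable (at y)"
    and X: "(X has_derivative X') (at y)"
  shows "((\<lambda>z. L z (X z)) has_derivative (\<lambda>u. D (\<lambda>z. L z (X y)) y u + L y (X' u))) (at y)"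
proof -
  have "((\<lambda>z. \<Sum>b\<in>Basis. (X z \<bullet> b) *\<^sub>R L z b) has_derivative
      (\<lambda>u. \<Sum>b\<in>Basis. (X y \<bullet> b) *\<^sub>R D (\<lambda>z. L z b) y u + (X' u \<bullet> b) *\<^sub>R L y b)) (at y)"
    by (intro has_derivative_sum has_derivative_scaleR has_derivative_D diff
        bounded_linear.has_derivative[OF bounded_linear_inner_left] X)
  moreover have "(\<Sum>b\<in>Basis. (X y \<bullet> b) *\<^sub>R D (\<lambda>z. L z b) y u + (X' u \<bullet> b) *\<^sub>R L y b)
      = D (\<lambda>z. L z (X y)) y u + L y (X' u)" for u
  proof -
    have "linear (\<lambda>v. D (\<lambda>z. L z v) y u)"
      by (rule linear_D_field[OF S]) (auto intro: lin diff)
    from linear_basis_expansion[OF this, of "X y"] linear_basis_expansion[OF lin[OF S(2)], of "X' u"]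
    show ?thesis by (simp only: sum.distrib)
  qed
  ultimately have "((\<lambda>z. \<Sum>b\<in>Basis. (X z \<bullet> b) *\<^sub>R L z b) has_derivative
      (\<lambda>u. D (\<lambda>z. L z (X y)) y u + L y (X' u))) (at y)"
    by simp
  then show ?thesis
  proof (rule has_derivative_transform_within_open[OF _ S])
    show "(\<Sum>b\<in>Basis. (X z \<bullet> b) *\<^sub>R L z b) = L z (X z)" if "z \<in> S" for z
      using linear_basis_expansion[OF lin[OF that], of "X z"] by simp
  qed
qed

text \<open>The product rule does not apply, as \<open>p\<close> is merely continuous. But
  \<open>q y\<close> is bounded by a multiple of \<open>norm (y - x)\<close> near \<open>x\<close>
  and \<open>p\<close> tends to 0, so the product is of smaller order.\<close>

lemma has_derivative_scaleR_vanishing: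
  fixes p :: "'a::real_normed_vector \<Rightarrow> real" and q :: "'a \<Rightarrow> 'c::real_normed_vector"
  assumes p: "isCont p x" "p x = 0" and q: "(q has_derivative q') (at x)" "q x = 0"
  shows "((\<lambda>y. p y *\<^sub>R q y) has_derivative (\<lambda>u. 0)) (at x)"
proof -
  obtain K where K: "\<And>u. norm (q' u) \<le> norm u * K"
    using bounded_linear.bounded[OF has_derivative_bounded_linear[OF q(1)]] by blast
  define \<rho> where "\<rho> y = norm (q y - q' (y - x)) / norm (y - x)" for y
  have \<rho>: "(\<rho> \<longlongrightarrow> 0) (at x)"
    using q unfolding has_derivative_iff_norm \<rho>_def by simp
  have "norm (norm (p y *\<^sub>R q y) / norm (y - x)) \<le> \<bar>p y\<bar> * (\<rho> y + K)" if "y \<noteq> x" for y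
  proof -
    have "norm (q y) \<le> norm (q y - q' (y - x)) + norm (y - x) * K"
      using norm_triangle_sub[of "q y" "q' (y - x)"] K[of "y - x"] by linarith
    then have "norm (q y) / norm (y - x) \<le> \<rho> y + K"
      using that by (simp add: \<rho>_def field_simps)
    then show ?thesis
      using mult_left_mono[of "norm (q y) / norm (y - x)" "\<rho> y + K" "\<bar>p y\<bar>"] by simp
  qed
  then have bound: "\<forall>\<^sub>F y in at x. norm (norm (p y *\<^sub>R q y) / norm (y - x)) \<le> \<bar>p y\<bar> * (\<rho> y + K)"
    by (auto simp: eventually_at_filter)
  have "((\<lambda>y. \<bar>p y\<bar> * (\<rho> y + K)) \<longlongrightarrow> \<bar>0\<bar> * (0 + K)) (at x)"
    using p by (intro tendsto_intros \<rho>) (auto simp: isCont_def)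
  then have "((\<lambda>y. norm (p y *\<^sub>R q y) / norm (y - x)) \<longlongrightarrow> 0) (at x)"
    by (intro Lim_null_comparison[OF bound]) simp
  then show ?thesis
    using p q by (simp add: has_derivative_iff_norm)
qed

section \<open>Smooth dependence of the solution of a linear equation on a parameter\<close>

context
  fixes S :: "'a::real_normed_vector set" and L :: "'a \<Rightarrow> 'b::euclidean_space \<Rightarrow> 'b"
  assumes S: "open S" and lin: "\<And>y. y \<in> S \<Longrightarrow> linear (L y)" and inj: "\<And>y. y \<in> S \<Longrightarrow> inj (L y)"
    and smooth: "\<And>v. smooth_on S (\<lambda>y. L y v)"
begin

text \<open>Injectivity gives \<open>L y0\<close> a lower bound \<open>c > 0\<close>, and
  \<open>c / 2\<close> still serves for \<open>L y\<close> nearby. Hence \<open>x y - x y0\<close>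
  is controlled by the residual \<open>w y - L y (x y0)\<close>, which tends to 0.\<close>

lemma solution_continuous:
  assumes y0: "y0 \<in> S" and sol: "\<And>y. y \<in> S \<Longrightarrow> L y (x y) = w y" and w: "isCont w y0"
  shows "isCont x y0"
proof -
  have L0: "isCont (\<lambda>y. L y v) y0" for v
    using smooth_on_differentiable[OF smooth y0] by (rule differentiable_imp_continuous_within)
  obtain c where c: "c > 0" "\<And>v. c * norm v \<le> norm (L y0 v)"
    using linear_inj_bounded_below_pos[OF lin[OF y0] inj[OF y0]] by (metis mult.commute)
  \<comment> \<open>A bound for the operator norm of \<open>L y - L y0\<close> that needs only the
    values on the basis.\<close>
  define \<beta> where "\<beta> y = (\<Sum>b\<in>Basis. norm (L y b - L y0 b))" for y
  have "(\<beta> \<longlongrightarrow> (\<Sum>b\<in>Basis. norm (L y0 b - L y0 b :: 'b))) (at y0)"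
    unfolding \<beta>_def using L0 by (intro tendsto_intros) (auto simp: isCont_def)
  then have ev: "\<forall>\<^sub>F y in at y0. \<beta> y < c / 2"
    using c by (intro order_tendstoD) auto
  have evS: "\<forall>\<^sub>F y in at y0. y \<in> S"
    using S y0 by (simp add: eventually_at_in_open')
  have bound: "\<forall>\<^sub>F y in at y0. norm (x y - x y0) \<le> 2 / c * norm (w y - L y (x y0))"
    using ev evS
  proof eventually_elim
    case (elim y)
    define d where "d = x y - x y0"
    have "norm (L y d - L y0 d) = norm (\<Sum>b\<in>Basis. (d \<bullet> b) *\<^sub>R (L y b - L y0 b))"
      using linear_basis_expansion[OF lin[OF elim(2)], of d]
        linear_basis_expansion[OF lin[OF y0], of d]
      by (simp add: scaleR_diff_right sum_subtractf)
    also have "\<dots> \<le> (\<Sum>b\<in>Basis. norm d * norm (L y b - L y0 b))"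
      by (intro sum_norm_le) (simp add: mult_right_mono Basis_le_norm)
    also have "\<dots> = norm d * \<beta> y"
      by (simp add: \<beta>_def sum_distrib_left)
    also have "\<dots> \<le> norm d * (c / 2)"
      using elim by (intro mult_left_mono) auto
    finally have "norm (L y d - L y0 d) \<le> norm d * (c / 2)" .
    moreover have "norm (L y d) = norm (w y - L y (x y0))"
      using elim sol by (simp add: d_def linear_diff[OF lin])
    moreover have "norm (L y0 d) \<le> norm (L y d) + norm (L y d - L y0 d)"
      by (rule norm_triangle_sub[of "L y0 d" "L y d", unfolded norm_minus_commute[of "L y0 d"]])
    ultimately have "c / 2 * norm d \<le> norm (w y - L y (x y0))"
      using c(2)[of d] by argo
    then show ?case
      using c(1) by (simp add: d_def field_simps)
  qed
  have "((\<lambda>y. 2 / c * norm (w y - L y (x y0))) \<longlongrightarrow> 2 / c * norm (w y0 - L y0 (x y0))) (at y0)"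
    using L0 w by (intro tendsto_intros) (auto simp: isCont_def)
  then have "((\<lambda>y. x y - x y0) \<longlongrightarrow> 0) (at y0)"
    by (intro Lim_null_comparison[OF bound]) (simp add: sol[OF y0])
  then show ?thesis
    by (simp add: isCont_def LIM_zero_iff)
qed

text \<open>Solve for \<open>L y0 (x y)\<close>. The term \<open>r y\<close>, which is
  \<open>L y - L y0\<close> applied to \<open>x y - x y0\<close>, is a sum of products of a
  continuous and a differentiable factor that both vanish at \<open>y0\<close>, hence differentiable
  there; the other terms are differentiable by assumption. A left inverse of \<open>L y0\<close>
  recovers \<open>x y\<close>.\<close>

lemma solution_differentiable:
  assumes y0: "y0 \<in> S" and sol: "\<And>y. y \<in> S \<Longrightarrow> L y (x y) = w y" and w: "w differentiable (at y0)"
  shows "x differentiable (at y0)"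
proof -
  have x: "isCont x y0"
    using solution_continuous[OF y0 sol] w differentiable_imp_continuous_within by blast
  have L0: "(\<lambda>y. L y v) differentiable (at y0)" for v
    by (rule smooth_on_differentiable[OF smooth y0])
  obtain G where G: "linear G" "G \<circ> L y0 = id"
    using linear_injective_left_inverse[OF lin[OF y0] inj[OF y0]] by blast
  define r where "r y = (\<Sum>b\<in>Basis. ((x y - x y0) \<bullet> b) *\<^sub>R (L y b - L y0 b))" for y
  have summand: "((\<lambda>y. ((x y - x y0) \<bullet> b) *\<^sub>R (L y b - L y0 b)) has_derivative (\<lambda>u. 0)) (at y0)" for b
  proof (rule has_derivative_scaleR_vanishing)
    show "isCont (\<lambda>y. (x y - x y0) \<bullet> b) y0"
      using x by (intro continuous_intros)
    show "((\<lambda>y. L y b - L y0 b) has_derivative (\<lambda>u. D (\<lambda>y. L y b) y0 u - 0)) (at y0)"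
      by (intro has_derivative_diff has_derivative_D L0 has_derivative_const)
  qed auto
  have "(r has_derivative (\<lambda>u. \<Sum>b\<in>(Basis::'b set). 0)) (at y0)"
    unfolding r_def by (intro has_derivative_sum summand)
  then have "r differentiable (at y0)"
    by (auto simp: differentiable_def)
  then have "(\<lambda>y. w y - r y - L y (x y0) + L y0 (x y0)) differentiable (at y0)"
    by (intro differentiable_add differentiable_diff differentiable_const L0 w)
  from bounded_linear.has_derivative[OF G(1)[unfolded linear_conv_bounded_linear] has_derivative_D[OF this]]
  have diff: "(\<lambda>y. G (w y - r y - L y (x y0) + L y0 (x y0))) differentiable (at y0)"
    unfolding differentiable_def by blast
  have "G (w y - r y - L y (x y0) + L y0 (x y0)) = x y" if "y \<in> S" for y
  proof -
    have "r y = L y (x y - x y0) - L y0 (x y - x y0)"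
      using linear_basis_expansion[OF lin[OF that], of "x y - x y0"]
        linear_basis_expansion[OF lin[OF y0], of "x y - x y0"]
      by (simp add: r_def scaleR_diff_right sum_subtractf)
    then have "w y - r y - L y (x y0) + L y0 (x y0) = L y0 (x y)"
      using sol[OF that] lin[OF that] lin[OF y0] by (simp add: linear_diff)
    then show ?thesis
      using G(2) by (metis comp_apply id_apply)
  qed
  then show ?thesis
    by (rule differentiable_cong_open[OF S y0 _ diff])
qed

text \<open>Differentiating \<open>L y (x y) = w y\<close> shows that a directional derivative of
  \<open>x\<close> solves an equation with the same \<open>L\<close>, whose right-hand side involves
  only \<open>x\<close> and derivatives of \<open>L\<close> and \<open>w\<close>. This drives an
  induction on the order.\<close>

lemma smooth_on_solution:
  assumes "\<And>y. y \<in> S \<Longrightarrow> L y (x y) = w y" "smooth_on S w"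
  shows "smooth_on S x"
proof -
  have "Ck_on k x S" if "Ck_on k w S" "\<And>y. y \<in> S \<Longrightarrow> L y (x y) = w y" for k x w
    using that
  proof (induction k arbitrary: x w)
    case 0
    then show ?case
      using S solution_continuous[of _ x w] by (simp add: continuous_on_eq_continuous_at)
  next
    case (Suc k)
    have diff: "x differentiable (at y)" if "y \<in> S" for y
      using solution_differentiable[OF that Suc.prems(2)] Suc.prems(1) that by simp
    have x: "Ck_on k x S"
      using Suc.IH[OF Ck_on_Suc_imp[OF Suc.prems(1)] Suc.prems(2)] .
    have "Ck_on k (\<lambda>y. D x y v) S" for v
    proof (rule Suc.IH)
      show "Ck_on k (\<lambda>y. D w y v + - (\<Sum>b\<in>Basis. (x y \<bullet> b) *\<^sub>R D (\<lambda>z. L z b) y v)) S"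
      proof (intro Ck_on_add[OF S] Ck_on_linear[OF S bounded_linear_minus[OF bounded_linear_ident]]
            Ck_on_sum[OF S] Ck_on_bilinear[OF S bounded_bilinear_scaleR])
        show "Ck_on k (\<lambda>y. D w y v) S"
          using Suc.prems(1) by simp
        show "Ck_on k (\<lambda>y. x y \<bullet> b) S" for b
          by (rule Ck_on_linear[OF S bounded_linear_inner_left x])
        show "Ck_on k (\<lambda>y. D (\<lambda>z. L z b) y v) S" for b
          using smooth_on_D[OF smooth] by (simp add: smooth_on_def)
      qed
      show "L y (D x y v) = D w y v + - (\<Sum>b\<in>Basis. (x y \<bullet> b) *\<^sub>R D (\<lambda>z. L z b) y v)"
        if y: "y \<in> S" for y
      proof -
        have Ld: "(\<lambda>z. L z b) differentiable (at y)" for b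
          by (rule smooth_on_differentiable[OF smooth y])
        have "linear (\<lambda>v'. D (\<lambda>z. L z v') y v)"
          by (rule linear_D_field[OF S y]) (auto intro: lin Ld)
        from linear_basis_expansion[OF this, of "x y"]
        have "D (\<lambda>z. L z (x y)) y v = (\<Sum>b\<in>Basis. (x y \<bullet> b) *\<^sub>R D (\<lambda>z. L z b) y v)" .
        moreover have "D w y = D (\<lambda>z. L z (x z)) y"
          by (rule D_cong[OF S y]) (simp add: Suc.prems(2))
        moreover have "D (\<lambda>z. L z (x z)) y = (\<lambda>u. D (\<lambda>z. L z (x y)) y u + L y (D x y u))"
          by (intro D_eqI has_derivative_apply[OF S y] lin Ld has_derivative_D diff[OF y])
        ultimately show ?thesis
          by simp
      qed
    qed
    with diff show ?case by simp
  qed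
  with assms show ?thesis unfolding smooth_on_def by blast
qed

end

subsection \<open>The shear of a complex structure\<close>

text \<open>Linear algebra in one tangent space: \<open>\<omega> u (I v)\<close> is the metric, and
  \<open>N\<close> is the value of the perturbing field at the point.\<close>

locale hermitian_shear =
  fixes \<omega> :: "'b::euclidean_space \<Rightarrow> 'b \<Rightarrow> real" and I N :: "'b \<Rightarrow> 'b"
  assumes bilinear: "bilinear \<omega>" and alternating: "\<omega> v v = 0"
    and linear_I: "linear I" and I_I: "I (I v) = - v"
    and compatible: "\<omega> (I u) (I v) = \<omega> u v"
    and positive: "v \<noteq> 0 \<Longrightarrow> \<omega> v (I v) > 0"
    and linear_N: "linear N" and N_N: "N (N v) = 0"
    and self_adjoint: "\<omega> (N u) v = \<omega> u (N v)"
begin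

lemmas \<omega>_simps = bilinear_ladd[OF bilinear] bilinear_radd[OF bilinear]
  bilinear_lsub[OF bilinear] bilinear_rsub[OF bilinear]
  bilinear_lneg[OF bilinear] bilinear_rneg[OF bilinear]

lemmas I_simps = linear_add[OF linear_I] linear_diff[OF linear_I] linear_neg[OF linear_I]
  linear_0[OF linear_I] I_I

lemmas N_simps = linear_add[OF linear_N] linear_diff[OF linear_N] linear_neg[OF linear_N]
  linear_0[OF linear_N] N_N

lemma skew: "\<omega> u v = - \<omega> v u"
proof -
  have "\<omega> (u + v) (u + v) = 0" by (rule alternating)
  then have "\<omega> u v + \<omega> v u = 0" unfolding \<omega>_simps by (simp add: alternating)
  then show ?thesis by simp
qed

lemma I_skew: "\<omega> (I u) v = - \<omega> u (I v)"
  using compatible[of u "I v"] by (simp add: I_simps \<omega>_simps)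

text \<open>Self-adjointness with respect to an alternating form makes
  \<open>\<omega> u (N v)\<close> skew in \<open>u\<close> and \<open>v\<close>, so it vanishes on
  the diagonal.\<close>

lemma N_isotropic: "\<omega> v (N v) = 0"
  using self_adjoint[of v v] skew[of "N v" v] by simp

lemma linear_shear: "linear (\<lambda>v. v - I (N v))"
  by (intro linear_compose_sub linear_ident linear_compose[OF linear_N linear_I, unfolded o_def])

lemma inj_shear: "inj (\<lambda>v. v - I (N v))"
proof (rule linear_injective_0[OF linear_shear, THEN iffD2], intro allI impI)
  fix v assume v: "v - I (N v) = 0"
  then have "\<omega> (N v) (I (N v)) = 0"
    using N_isotropic[of v] skew[of v] by simp
  then have "N v = 0"
    using positive by force
  with v show "v = 0" by (simp add: I_simps)
qed

lemma surj_shear: "surj (\<lambda>v. v - I (N v))"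
  using linear_injective_imp_surjective[OF linear_shear inj_shear] by simp

lemma shear_eqI: "u - I (N u) = v - I (N v) \<Longrightarrow> u = v"
  using inj_shear by (auto dest: injD)

text \<open>Makes the results available for \<open>- C\<close>, to which the second complex
  structure belongs.\<close>

lemma negative: "hermitian_shear \<omega> I (\<lambda>v. - N v)"
  by (rule hermitian_shear.intro) (simp_all add: alternating I_I compatible positive self_adjoint
      bilinear linear_I linear_compose_neg linear_N N_simps \<omega>_simps)

context
  fixes J :: "'b \<Rightarrow> 'b"
  assumes J: "\<And>v. J v - I (N (J v)) = I v + N v"
begin

lemma J_eq: "J v = I v + N v + I (N (J v))"
  using J[of v] by (simp add: algebra_simps)

text \<open>\<open>J\<close> is known only through \<open>B J = I B\<close> with
  \<open>B v = v - I (N v)\<close>. Linearity, and likewise \<open>J J = - 1\<close> below, is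
  checked after applying the injective map \<open>B\<close>.\<close>

lemma linear_J: "linear J"
proof (rule linearI)
  fix u v :: 'b and r :: real
  show "J (u + v) = J u + J v"
  proof (rule shear_eqI)
    have "J (u + v) - I (N (J (u + v))) = (J u - I (N (J u))) + (J v - I (N (J v)))"
      unfolding J by (simp add: I_simps N_simps)
    then show "J (u + v) - I (N (J (u + v))) = (J u + J v) - I (N (J u + J v))"
      by (simp add: I_simps N_simps)
  qed
  show "J (r *\<^sub>R v) = r *\<^sub>R J v"
  proof (rule shear_eqI)
    have "J (r *\<^sub>R v) - I (N (J (r *\<^sub>R v))) = r *\<^sub>R (J v - I (N (J v)))"
      unfolding J by (simp add: linear_cmul[OF linear_I] linear_cmul[OF linear_N] scaleR_add_right)
    then show "J (r *\<^sub>R v) - I (N (J (r *\<^sub>R v))) = r *\<^sub>R J v - I (N (r *\<^sub>R J v))"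
      by (simp add: linear_cmul[OF linear_I] linear_cmul[OF linear_N] scaleR_diff_right)
  qed
qed

lemma J_J: "J (J v) = - v"
proof (rule shear_eqI)
  have "I (J v) = - v + I (N v) - N (J v)"
    by (subst J_eq) (simp add: I_simps)
  then show "J (J v) - I (N (J (J v))) = - v - I (N (- v))"
    using J[of "J v"] by (simp add: I_simps N_simps)
qed

lemma J_positive:
  assumes "v \<noteq> 0"
  shows "\<omega> v (J v) > 0"
proof -
  define w where "w = v + N (J v)"
  have Iw: "I w = J v - N v"
    using J_eq[of v] by (simp add: w_def I_simps algebra_simps)
  have "\<omega> (N (J v)) (J v) = 0" "\<omega> (N (J v)) (N v) = 0"
    using N_isotropic[of "J v"] skew[of "N (J v)" "J v"] self_adjoint[of "J v" "N v"] linear_0[OF linear_N]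
    by (simp_all add: N_simps bilinear_rzero[OF bilinear])
  \<comment> \<open>In the expansion of \<open>\<omega> w (I w)\<close> all terms but
    \<open>\<omega> v (J v)\<close> vanish, by isotropy and \<open>N N = 0\<close>.\<close>
  then have eq: "\<omega> v (J v) = \<omega> w (I w)"
    unfolding Iw by (simp add: w_def \<omega>_simps N_isotropic)
  \<comment> \<open>If \<open>w = 0\<close>, then \<open>J v = N v\<close>, and so
    \<open>v = - N (J v) = - N (N v) = 0\<close>.\<close>
  have "w \<noteq> 0"
  proof
    assume "w = 0"
    then have "J v = N v" "v = - N (J v)"
      using Iw by (simp_all add: I_simps w_def eq_neg_iff_add_eq_0)
    then show False
      using assms by (simp add: N_simps)
  qed
  then show ?thesis
    using positive eq by simp
qed

text \<open>\<open>K\<close> is the structure sheared by \<open>- N\<close>. Applying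
  \<open>N\<close> to the two defining equations gives \<open>N I = N K + N I N K\<close> and
  \<open>N I = N J - N I N J\<close>. With these the correction term
  \<open>\<omega> u (I (N (J v)))\<close> becomes \<open>\<omega> (I (N (K u))) v\<close>; the
  remaining terms match because \<open>I\<close> is skew and \<open>N\<close> self-adjoint.\<close>

lemma J_adjoint:
  assumes K: "\<And>v. K v + I (N (K v)) = I v - N v"
  shows "\<omega> (K u) v = - \<omega> u (J v)"
proof -
  have "\<omega> u (I (N (J v))) = - \<omega> (N (I u)) (J v)"
    using I_skew[of u "N (J v)"] self_adjoint[of "I u" "J v"] by simp
  also have "N (I u) = N (K u) + N (I (N (K u)))"
    using arg_cong[OF K[of u], of N] by (simp add: N_simps)
  also have "\<omega> \<dots> (J v) = \<omega> (K u) (N (J v) - N (I (N (J v))))"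
    by (simp add: \<omega>_simps self_adjoint I_skew)
  also have "N (J v) - N (I (N (J v))) = N (I v)"
    using arg_cong[OF J[of v], of N] by (simp add: N_simps)
  finally have "\<omega> u (I (N (J v))) = \<omega> (I (N (K u))) v"
    by (simp add: I_skew self_adjoint)
  then have "\<omega> u (J v) = \<omega> u (I v) + \<omega> u (N v) + \<omega> (I (N (K u))) v"
    by (subst J_eq) (simp add: \<omega>_simps)
  moreover have "\<omega> (K u) v = \<omega> (I u) v - \<omega> (N u) v - \<omega> (I (N (K u))) v"
    using arg_cong[OF K[of u], of "\<lambda>x. \<omega> x v"] by (simp add: \<omega>_simps)
  ultimately show ?thesis
    by (simp add: I_skew self_adjoint)
qed

text \<open>On \<open>W\<close> one has \<open>J w = I (w + N (J w))\<close> and conversely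
  \<open>I w = J (w - N (I w))\<close>. The image is independent of the sign of \<open>N\<close>,
  which is the reason for the equality of images required in \<open>DGK\<close>.\<close>

lemma image_J:
  assumes W: "subspace W" "\<And>w. w \<in> W \<Longrightarrow> N w = 0" "\<And>v. N v \<in> W"
  shows "J ` W = I ` W"
proof (intro equalityI image_subsetI)
  fix w assume w: "w \<in> W"
  have "J w = I (w + N (J w))"
    using J_eq[of w] W(2)[OF w] by (simp add: I_simps)
  moreover have "w + N (J w) \<in> W"
    using W w by (simp add: subspace_add)
  ultimately show "J w \<in> I ` W" by blast
  have "J (I w) = N (I w) - w"
    by (rule shear_eqI) (simp add: J N_simps I_simps W(2)[OF w])
  then have "I w = J (w - N (I w))"
    using J_J[of "I w"] linear_neg[OF linear_J, of "N (I w) - w"] by (simp add: equation_minus_iff)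
  moreover have "w - N (I w) \<in> W"
    using W w by (simp add: subspace_diff)
  ultimately show "I w \<in> J ` W" by blast
qed

end

end

subsection \<open>The Nijenhuis tensor\<close>

text \<open>The derivatives of \<open>X\<close> and \<open>Y\<close> cancel by \<open>JJ\<close>, so
  only the vectors \<open>X y\<close> and \<open>Y y\<close> matter and integrability can be tested
  on constant fields.\<close>

lemma nijenhuis_tensorial:
  assumes S: "open S" "y \<in> S" and lin: "\<And>z. z \<in> S \<Longrightarrow> linear (J z)"
    and J: "\<And>v. (\<lambda>z. J z v) differentiable (at y)" and JJ: "\<And>v. J y (J y v) = - v"
    and X: "X differentiable (at y)" and Y: "Y differentiable (at y)"
  shows "nijenhuis J X Y y =
    D (\<lambda>z. J z (Y y)) y (J y (X y)) - D (\<lambda>z. J z (X y)) y (J y (Y y))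
    - J y (D (\<lambda>z. J z (Y y)) y (X y) - D (\<lambda>z. J z (X y)) y (Y y))"
proof -
  have "D (\<lambda>z. J z (X z)) y = (\<lambda>u. D (\<lambda>z. J z (X y)) y u + J y (D X y u))"
    "D (\<lambda>z. J z (Y z)) y = (\<lambda>u. D (\<lambda>z. J z (Y y)) y u + J y (D Y y u))"
    by (intro D_eqI has_derivative_apply[OF S] lin J has_derivative_D X Y; simp)+
  moreover have "linear (J y)" using lin S by simp
  ultimately show ?thesis
    by (simp add: nijenhuis_def lie_bracket_def linear_add linear_diff JJ)
qed

text \<open>Here \<open>A x w\<close> stands for \<open>\<Sum>\<^sub>k m\<^sub>k(w) D\<^sub>x Z\<^sub>k\<close>, where \<open>P = \<Sum>\<^sub>k m\<^sub>k \<otimes> Z\<^sub>k\<close> is the perturbation and \<open>Q\<close>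
  its derivative; the primed maps are derivatives of \<open>I\<close> and \<open>J\<close>.\<close>

lemma nijenhuis_conjugate:
  fixes I P J :: "'b::real_vector \<Rightarrow> 'b" and I' J' Q A :: "'b \<Rightarrow> 'b \<Rightarrow> 'b"
  assumes I: "linear I" "\<And>v. I (I v) = - v"
    and P: "linear P" "\<And>v. v - P v = 0 \<Longrightarrow> v = 0"
    and J: "\<And>v. J v - P (J v) = I (v - P v)"
    and lin: "\<And>v. linear (\<lambda>u. I' u v)" "\<And>w. linear (\<lambda>x. A x w)"
    and J': "\<And>u v. J' u v - P (J' u v) = I' u (v - P v) - I (Q u v) + Q u (J v)"
    and Q: "\<And>u v. Q u v - Q v u = A u v - A v u"
    and integrable: "\<And>u v. I' (I u) v - I (I' u v) = I' (I v) u - I (I' v u)"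
    and holomorphic: "\<And>w v. I' (P w) v = A (I v) w - I (A v w)"
    and commuting: "\<And>u v. A (P u) v = A (P v) u"
  shows "J' (J u) v - J' (J v) u - J (J' u v - J' v u) = 0"
proof (rule P(2))
  \<comment> \<open>The claim is checked after applying \<open>B = 1 - P\<close>, which has trivial
    kernel: \<open>B J = I B\<close> and the derivative of this relation, \<open>J'B\<close>, then
    remove the outer \<open>J\<close> and \<open>J'\<close>.\<close>
  define B where "B v = v - P v" for v
  note I_simps = linear_add[OF I(1)] linear_diff[OF I(1)] linear_neg[OF I(1)] I(2)
  have B: "B (x - y) = B x - B y" for x y
    by (simp add: B_def linear_diff[OF P(1)])
  have J'B: "B (J' u v) = I' u (B v) - I (Q u v) + Q u (J v)" for u v
    using J' by (simp add: B_def)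
  have JB: "B (J v) = I (B v)" for v
    using J by (simp add: B_def)
  \<comment> \<open>Splitting \<open>J u = I (B u) + P (J u)\<close> and
    \<open>u = B u + P u\<close> separates an expression in \<open>I\<close> alone, fit for
    integrability, from derivatives along values of \<open>P\<close>, which
    \<open>holomorphic\<close> expresses by \<open>A\<close>.\<close>
  have F: "I' (J u) (B v) - I (I' u (B v)) =
      (I' (I (B u)) (B v) - I (I' (B u) (B v)))
      + (A (I (B v)) (J u) - I (A (B v) (J u))) - (I (A (I (B v)) u) + A (B v) u)" for u v
  proof -
    have "J u = I (B u) + P (J u)" "u = B u + P u"
      using JB[of u] by (simp_all add: B_def algebra_simps)
    then have "I' (J u) (B v) = I' (I (B u)) (B v) + I' (P (J u)) (B v)"
      "I' u (B v) = I' (B u) (B v) + I' (P u) (B v)"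
      using linear_add[OF lin(1), of "I (B u)"] linear_add[OF lin(1), of "B u"] by metis+
    then show ?thesis
      by (simp add: holomorphic I_simps)
  qed
  have G: "A v w = A (B v) w + A (P v) w" "A (J v) w = A (I (B v)) w + A (P (J v)) w" for v w
  proof -
    have "J v = I (B v) + P (J v)" "v = B v + P v"
      using JB[of v] by (simp_all add: B_def algebra_simps)
    then show "A v w = A (B v) w + A (P v) w" "A (J v) w = A (I (B v)) w + A (P (J v)) w"
      using linear_add[OF lin(2)] by metis+
  qed
  have Q': "Q u v = Q v u + A u v - A v u" for u v
    using Q[of u v] by (simp add: algebra_simps)
  show "J' (J u) v - J' (J v) u - J (J' u v - J' v u)
      - P (J' (J u) v - J' (J v) u - J (J' u v - J' v u)) = 0" (is "?N - P ?N = 0")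
  proof -
    \<comment> \<open>\<open>Q\<close> enters only through skew combinations, so it can be replaced
      by \<open>A\<close>.\<close>
    have "?N - P ?N = (I' (J u) (B v) - I (I' u (B v))) - (I' (J v) (B u) - I (I' v (B u)))
        - I ((Q (J u) v - Q v (J u)) + (Q u (J v) - Q (J v) u))
        + (Q (J u) (J v) - Q (J v) (J u)) - (Q u v - Q v u)"
      unfolding B_def[symmetric] B J'B JB by (simp add: I_simps B J'B)
    also have "\<dots> = 0"
      unfolding F Q G[of u] G[of v] using integrable[of "B u" "B v"]
        commuting[of u v] commuting[of "J u" v] commuting[of u "J v"] commuting[of "J u" "J v"]
      by (simp add: I_simps algebra_simps)
    finally show ?thesis .
  qed
qed

subsection \<open>Charts and the torus\<close>

lemma is_chartD:
  assumes "is_chart c"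
  shows "open (cdom c)" "open (cimg c)"
    "p \<in> cdom c \<Longrightarrow> cinv c (coord c p) = p"
    "y \<in> cimg c \<Longrightarrow> cinv c y \<in> cdom c" "y \<in> cimg c \<Longrightarrow> coord c (cinv c y) = y"
    "continuous_on (cdom c) (coord c)" "continuous_on (cimg c) (cinv c)"
  using assms unfolding is_chart_def homeomorphism_def by auto

lemma texp_in_torus: "texp \<xi> \<in> torus"
  by (simp add: texp_def torus_def)

lemma texp_0: "texp 0 = 1"
  by (simp add: texp_def vec_eq_iff)

lemma texp_add: "texp (\<xi> + \<eta>) = texp \<xi> * texp \<eta>"
  by (simp add: texp_def vec_eq_iff cis_mult)

lemma torus_texp:
  assumes "z \<in> torus"
  shows "\<exists>\<xi>. z = texp \<xi>"
proof
  have "cis (Arg w) = w" if "norm w = 1" for w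
    using that cis_Arg[of w] by (force simp: sgn_div_norm)
  then show "z = texp (\<chi> i. Arg (z $ i))"
    using assms by (simp add: texp_def torus_def vec_eq_iff)
qed

lemma continuous_on_texp [continuous_intros]: "continuous_on S f \<Longrightarrow> continuous_on S (\<lambda>x. texp (f x))"
  unfolding texp_def by (intro continuous_intros)

text \<open>The field \<open>N\<close> of the overview: on a toric manifold
  \<open>\<Omega> c p v (X k c p)\<close> is the differential of the \<open>k\<close>-th moment
  component at \<open>v\<close>.\<close>

definition shear ::
    "real ^ 'n ^ 'n \<Rightarrow> ('a, 'b::euclidean_space) form2 \<Rightarrow> ('n::finite \<Rightarrow> ('a, 'b) vfield) \<Rightarrow> ('a, 'b) endo"
  where "shear C \<Omega> X c p v = (\<Sum>k\<in>UNIV. \<Sum>j\<in>UNIV. (C $ k $ j * \<Omega> c p v (X k c p)) *\<^sub>R X j c p)"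

locale toric_kaehler_manifold =
  fixes A :: "('a::{t2_space,second_countable_topology}, 'n::finite model) chart set"
    and \<Omega> :: "('a, 'n model) form2"
    and a :: "complex ^ 'n \<Rightarrow> 'a \<Rightarrow> 'a"
    and e :: "'n \<Rightarrow> real ^ 'n"
    and \<mu> :: "'a \<Rightarrow> real ^ 'n"
    and I :: "('a, 'n model) endo"
  assumes toric: "toric_symplectic_manifold A \<Omega> a e \<mu>"
    and kaehler: "I \<in> toric_Kaehler A \<Omega> a"
begin

abbreviation X :: "'n \<Rightarrow> ('a, 'n model) vfield" where
  "X k \<equiv> fund_field a (e k)"

lemma chart: "c \<in> A \<Longrightarrow> is_chart c"
  using toric unfolding toric_symplectic_manifold_def smooth_structure_def by blast

lemmas chartD = is_chartD[OF chart]

lemma action_1: "a 1 p = p"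
  and action_mult: "z \<in> torus \<Longrightarrow> w \<in> torus \<Longrightarrow> a (z * w) p = a z (a w p)"
  and action_continuous: "continuous_on (torus \<times> UNIV) (\<lambda>(z, p). a z p)"
  and action_smooth: "c \<in> A \<Longrightarrow> d \<in> A \<Longrightarrow> smooth_on
        {(\<xi>, y). y \<in> cimg c \<and> a (texp \<xi>) (cinv c y) \<in> cdom d}
        (\<lambda>(\<xi>, y). coord d (a (texp \<xi>) (cinv c y)))"
  using toric unfolding toric_symplectic_manifold_def smooth_torus_action_def by blast+

lemma action_texp_add: "a (texp (\<xi> + \<eta>)) p = a (texp \<xi>) (a (texp \<eta>) p)"
  by (simp add: texp_add action_mult texp_in_torus)

section \<open>The torus action read in charts\<close>

definition flow_dom :: "('a, 'n model) chart \<Rightarrow> ('a, 'n model) chart \<Rightarrow> ((real ^ 'n) \<times> 'n model) set" where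
  "flow_dom c d = {(\<xi>, y). y \<in> cimg c \<and> a (texp \<xi>) (cinv c y) \<in> cdom d}"

text \<open>Fundamental fields and differentials of torus elements are both partial derivatives of
  this one smooth map, so exchanging them amounts to symmetry of second derivatives.\<close>

definition flow :: "('a, 'n model) chart \<Rightarrow> ('a, 'n model) chart \<Rightarrow> (real ^ 'n) \<times> 'n model \<Rightarrow> 'n model" where
  "flow c d = (\<lambda>(\<xi>, y). coord d (a (texp \<xi>) (cinv c y)))"

lemma smooth_flow: "c \<in> A \<Longrightarrow> d \<in> A \<Longrightarrow> smooth_on (flow_dom c d) (flow c d)"
  unfolding flow_dom_def flow_def by (rule action_smooth)

lemma open_flow_dom:
  assumes "c \<in> A" "d \<in> A"
  shows "open (flow_dom c d)"
proof -
  have "continuous_on (UNIV \<times> cimg c) ((\<lambda>(z, p). a z p) \<circ> (\<lambda>(\<xi>, y). (texp \<xi>, cinv c y)))"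
  proof (rule continuous_on_compose)
    show "continuous_on (UNIV \<times> cimg c) (\<lambda>(\<xi>, y). (texp \<xi>, cinv c y))"
      unfolding case_prod_unfold
      by (intro continuous_intros continuous_on_compose2[OF chartD(7)[OF assms(1)]]) auto
    show "continuous_on ((\<lambda>(\<xi>, y). (texp \<xi>, cinv c y)) ` (UNIV \<times> cimg c)) (\<lambda>(z, p). a z p)"
      by (rule continuous_on_subset[OF action_continuous]) (auto simp: texp_in_torus)
  qed
  moreover have "open (UNIV \<times> cimg c)"
    using chartD(2)[OF assms(1)] by (simp add: open_Times)
  ultimately have "open (((\<lambda>(z, p). a z p) \<circ> (\<lambda>(\<xi>, y). (texp \<xi>, cinv c y))) -` cdom d \<inter> (UNIV \<times> cimg c))"
    using chartD(1)[OF assms(2)] continuous_on_open_vimage by blast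
  also have "((\<lambda>(z, p). a z p) \<circ> (\<lambda>(\<xi>, y). (texp \<xi>, cinv c y))) -` cdom d \<inter> (UNIV \<times> cimg c) = flow_dom c d"
    by (auto simp: flow_dom_def)
  finally show ?thesis .
qed

lemma flow_0: "c \<in> A \<Longrightarrow> y \<in> cimg c \<Longrightarrow> (0, y) \<in> flow_dom c c" "c \<in> A \<Longrightarrow> y \<in> cimg c \<Longrightarrow> flow c c (0, y) = y"
  using chartD(4,5)[of c y] by (simp_all add: flow_dom_def flow_def texp_0 action_1)

lemma has_derivative_flow:
  "c \<in> A \<Longrightarrow> d \<in> A \<Longrightarrow> z \<in> flow_dom c d \<Longrightarrow> (flow c d has_derivative D (flow c d) z) (at z)"
  by (rule has_derivative_D[OF smooth_on_differentiable[OF smooth_flow]])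

context
  fixes c d :: "('a, 'n model) chart" and z p
  assumes c: "c \<in> A" and d: "d \<in> A" and z: "z \<in> torus" and p: "p \<in> cdom c" "a z p \<in> cdom d"
begin

text \<open>\<open>dmap\<close> carries information only once differentiability is known. It follows
  from the smoothness of the flow with the Lie algebra variable frozen, as every torus element is
  some \<open>texp \<xi>\<close>.\<close>

lemma dmap_has_derivative:
  "((coord d \<circ> a z \<circ> cinv c) has_derivative dmap c d (a z) p) (at (coord c p))"
proof -
  obtain \<xi> where \<xi>: "z = texp \<xi>" using torus_texp[OF z] by blast
  have "(\<xi>, coord c p) \<in> flow_dom c d"
    using p chartD(3)[OF c] by (simp add: flow_dom_def \<xi>)
  from has_derivative_flow[OF c d this]
  have "((\<lambda>y. flow c d (\<xi>, y)) has_derivative (\<lambda>v. D (flow c d) (\<xi>, coord c p) (0, v))) (at (coord c p))"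
    by (rule has_derivative_compose[rotated]) (auto intro!: derivative_eq_intros)
  moreover have "(\<lambda>y. flow c d (\<xi>, y)) = coord d \<circ> a z \<circ> cinv c"
    by (simp add: flow_def \<xi> fun_eq_iff)
  ultimately have "(coord d \<circ> a z \<circ> cinv c) differentiable at (coord c p)"
    unfolding differentiable_def by auto
  then show ?thesis
    unfolding dmap_def dfun_def by (rule has_derivative_D)
qed

lemma linear_dmap: "linear (dmap c d (a z) p)"
  using dmap_has_derivative by (rule has_derivative_linear)

lemma form_dmap: "\<Omega> d (a z p) (dmap c d (a z) p u) (dmap c d (a z) p v) = \<Omega> c p u v"
  using toric c d z p unfolding toric_symplectic_manifold_def form2_invariant_def by blast

lemma I_dmap: "I d (a z p) (dmap c d (a z) p v) = dmap c d (a z) p (I c p v)"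
  using kaehler c d z p unfolding toric_Kaehler_def endo_invariant_def by blast

end

lemma bilinear_form: "c \<in> A \<Longrightarrow> p \<in> cdom c \<Longrightarrow> bilinear (\<Omega> c p)"
  and alternating_form: "c \<in> A \<Longrightarrow> p \<in> cdom c \<Longrightarrow> \<Omega> c p v v = 0"
  and smooth_form: "c \<in> A \<Longrightarrow> smooth_on (cimg c) (\<lambda>y. \<Omega> c (cinv c y) u v)"
  and nondegenerate: "c \<in> A \<Longrightarrow> p \<in> cdom c \<Longrightarrow> (\<And>v. \<Omega> c p u v = 0) \<Longrightarrow> u = 0"
  using toric unfolding toric_symplectic_manifold_def symplectic_form_def two_form_def by blast+

lemma skew_form:
  assumes "c \<in> A" "p \<in> cdom c"
  shows "\<Omega> c p u v = - \<Omega> c p v u"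
proof -
  note b = bilinear_form[OF assms]
  have "\<Omega> c p (u + v) (u + v) = 0" by (rule alternating_form[OF assms])
  then have "\<Omega> c p u v + \<Omega> c p v u = 0"
    unfolding bilinear_ladd[OF b] bilinear_radd[OF b] by (simp add: alternating_form[OF assms])
  then show ?thesis by simp
qed

lemma nondegenerate_eq:
  assumes "c \<in> A" "p \<in> cdom c" "\<And>v. \<Omega> c p u v = \<Omega> c p u' v"
  shows "u = u'"
  using nondegenerate[OF assms(1,2), of "u - u'"] assms(3)
  by (simp add: bilinear_lsub[OF bilinear_form[OF assms(1,2)]])

text \<open>A linear map that preserves a nondegenerate form is injective, hence bijective between
  model spaces of equal dimension.\<close>

lemma surj_dmap:
  assumes "c \<in> A" "d \<in> A" "z \<in> torus" "p \<in> cdom c" "a z p \<in> cdom d"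
  shows "surj (dmap c d (a z) p)"
proof -
  note lin = linear_dmap[OF assms]
  have "u = 0" if u: "dmap c d (a z) p u = 0" for u
  proof (rule nondegenerate[OF assms(1,4)])
    show "\<Omega> c p u v = 0" for v
      using form_dmap[OF assms, of u v] bilinear_lzero[OF bilinear_form[OF assms(2,5)]] by (simp add: u)
  qed
  then have "inj (dmap c d (a z) p)"
    using linear_injective_0[OF lin] by blast
  then show ?thesis
    using linear_injective_imp_surjective[OF lin] by blast
qed

lemma linear_I: "c \<in> A \<Longrightarrow> p \<in> cdom c \<Longrightarrow> linear (I c p)"
  and smooth_I: "c \<in> A \<Longrightarrow> smooth_on (cimg c) (\<lambda>y. I c (cinv c y) v)"
  and I_I: "c \<in> A \<Longrightarrow> p \<in> cdom c \<Longrightarrow> I c p (I c p v) = - v"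
  and I_integrable: "c \<in> A \<Longrightarrow> y \<in> cimg c \<Longrightarrow> smooth_on (cimg c) V \<Longrightarrow> smooth_on (cimg c) W \<Longrightarrow>
    nijenhuis (\<lambda>z. I c (cinv c z)) V W y = 0"
  and I_positive: "c \<in> A \<Longrightarrow> p \<in> cdom c \<Longrightarrow> v \<noteq> 0 \<Longrightarrow> \<Omega> c p v (I c p v) > 0"
  and I_compatible: "c \<in> A \<Longrightarrow> p \<in> cdom c \<Longrightarrow> \<Omega> c p (I c p u) (I c p v) = \<Omega> c p u v"
  using kaehler unfolding toric_Kaehler_def complex_structure_def endo_field_def tamed_def by blast+

subsection \<open>The moment map and the fundamental fields\<close>

lemma smooth_moment:
  assumes c: "c \<in> A"
  shows "smooth_on (cimg c) (\<lambda>y. \<mu> (cinv c y) $ k)"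
proof (rule smooth_on_linear[OF chartD(2)[OF c] bounded_linear_vec_nth])
  have "smooth_fun A \<mu>"
    using toric unfolding toric_symplectic_manifold_def moment_map_def by blast
  then show "smooth_on (cimg c) (\<lambda>y. \<mu> (cinv c y))"
    using c unfolding smooth_fun_def o_def by blast
qed

lemma moment_invariant: "z \<in> torus \<Longrightarrow> \<mu> (a z p) = \<mu> p"
  using toric unfolding toric_symplectic_manifold_def moment_map_def by blast

lemma moment_has_derivative:
  assumes "c \<in> A" "p \<in> cdom c"
  shows "((\<lambda>y. \<mu> (cinv c y) $ k) has_derivative dfun c (\<lambda>q. \<mu> q $ k) p) (at (coord c p))"
  using has_derivative_D[OF smooth_on_differentiable[OF smooth_moment[OF assms(1)]], of "coord c p" k] assms(2)
  by (simp add: dfun_def o_def)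

lemma form_X: "c \<in> A \<Longrightarrow> p \<in> cdom c \<Longrightarrow> \<Omega> c p (X k c p) v = - dfun c (\<lambda>q. \<mu> q $ k) p v"
  using toric unfolding toric_symplectic_manifold_def moment_map_def by blast

lemma form_X': "c \<in> A \<Longrightarrow> p \<in> cdom c \<Longrightarrow> \<Omega> c p v (X k c p) = dfun c (\<lambda>q. \<mu> q $ k) p v"
  by (subst skew_form) (simp_all add: form_X)

text \<open>Chain rule for the invariance \<open>\<mu> (a z q) = \<mu> q\<close>.\<close>

lemma dfun_moment_dmap:
  assumes "c \<in> A" "d \<in> A" "z \<in> torus" "p \<in> cdom c" "a z p \<in> cdom d"
  shows "dfun d (\<lambda>q. \<mu> q $ k) (a z p) (dmap c d (a z) p v) = dfun c (\<lambda>q. \<mu> q $ k) p v"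
proof -
  obtain \<xi> where \<xi>: "z = texp \<xi>" using torus_texp[OF assms(3)] by blast
  define S where "S = Pair \<xi> -` flow_dom c d"
  have "open S"
    unfolding S_def by (intro open_vimage open_flow_dom assms continuous_intros)
  moreover have "coord c p \<in> S"
    using assms(4,5) chartD(3)[OF assms(1)] by (simp add: S_def \<xi> flow_dom_def)
  ultimately have S: "open S" "coord c p \<in> S" .
  have "coord d (a z p) = (coord d \<circ> a z \<circ> cinv c) (coord c p)"
    using chartD(3)[OF assms(1,4)] by simp
  from has_derivative_compose[OF dmap_has_derivative[OF assms]
      moment_has_derivative[OF assms(2,5), of k, unfolded this]]
  have "((\<lambda>y. \<mu> (cinv d ((coord d \<circ> a z \<circ> cinv c) y)) $ k) has_derivative
      (\<lambda>v. dfun d (\<lambda>q. \<mu> q $ k) (a z p) (dmap c d (a z) p v))) (at (coord c p))"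
    .
  then have "((\<lambda>y. \<mu> (cinv c y) $ k) has_derivative
      (\<lambda>v. dfun d (\<lambda>q. \<mu> q $ k) (a z p) (dmap c d (a z) p v))) (at (coord c p))"
  proof (rule has_derivative_transform_within_open[OF _ S])
    show "\<mu> (cinv d ((coord d \<circ> a z \<circ> cinv c) y)) $ k = \<mu> (cinv c y) $ k" if "y \<in> S" for y
      using that chartD(3)[OF assms(2)] moment_invariant[OF assms(3)]
      by (simp add: S_def flow_dom_def \<xi>)
  qed
  from has_derivative_unique[OF this moment_has_derivative[OF assms(1,4)]]
  show ?thesis by metis
qed

text \<open>\<Omega> and the differential of the moment component determine \<open>X k\<close>, and
  the action preserves both.\<close>

lemma X_dmap:
  assumes "c \<in> A" "d \<in> A" "z \<in> torus" "p \<in> cdom c" "a z p \<in> cdom d"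
  shows "X k d (a z p) = dmap c d (a z) p (X k c p)"
proof (rule nondegenerate_eq[OF assms(2,5)])
  fix v
  obtain u where "v = dmap c d (a z) p u"
    using surj_dmap[OF assms] by blast
  then show "\<Omega> d (a z p) (X k d (a z p)) v = \<Omega> d (a z p) (dmap c d (a z) p (X k c p)) v"
    using form_dmap[OF assms] form_X[OF assms(1,4)] form_X[OF assms(2,5)] dfun_moment_dmap[OF assms] by simp
qed

text \<open>By \<open>action_texp_add\<close>, moving along \<open>e k\<close> from the displaced
  point is the same as adding a multiple of \<open>e k\<close> to \<xi>.\<close>

lemma X_flow:
  assumes c: "c \<in> A" and z: "(\<xi>, y) \<in> flow_dom c c"
  shows "X k c (cinv c (flow c c (\<xi>, y))) = D (flow c c) (\<xi>, y) (e k, 0)"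
proof -
  have q: "cinv c (flow c c (\<xi>, y)) = a (texp \<xi>) (cinv c y)"
    using z chartD(3)[OF c] by (simp add: flow_dom_def flow_def)
  have "((\<lambda>s. flow c c (s *\<^sub>R e k + \<xi>, y)) has_derivative (\<lambda>h. D (flow c c) (\<xi>, y) (h *\<^sub>R e k, 0))) (at 0)"
    by (rule has_derivative_compose[of "\<lambda>s. (s *\<^sub>R e k + \<xi>, y)" "\<lambda>h. (h *\<^sub>R e k, 0)" 0 UNIV])
      (auto intro!: derivative_eq_intros has_derivative_flow c z)
  moreover have "D (flow c c) (\<xi>, y) (h *\<^sub>R e k, 0) = h *\<^sub>R D (flow c c) (\<xi>, y) (e k, 0)" for h
    using linear_cmul[OF has_derivative_linear[OF has_derivative_flow[OF c c z]], of h "(e k, 0)"] by simp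
  ultimately have "((\<lambda>s. flow c c (s *\<^sub>R e k + \<xi>, y)) has_vector_derivative D (flow c c) (\<xi>, y) (e k, 0)) (at 0)"
    by (simp add: has_vector_derivative_def)
  moreover have "(\<lambda>s. flow c c (s *\<^sub>R e k + \<xi>, y)) = (\<lambda>s. coord c (a (texp (s *\<^sub>R e k)) (cinv c (flow c c (\<xi>, y)))))"
    unfolding q by (simp add: flow_def action_texp_add)
  ultimately show ?thesis
    unfolding fund_field_def by (simp add: vector_derivative_at)
qed

text \<open>Contraction with \<Omega> sends \<open>X k\<close> to minus the differential of a moment
  component; this is a linear equation with smooth data, so \<open>smooth_on_solution\<close>
  applies.\<close>

lemma smooth_X:
  assumes c: "c \<in> A"
  shows "smooth_on (cimg c) (\<lambda>y. X k c (cinv c y))"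
proof -
  \<comment> \<open>The Euclidean basis turns covectors into vectors, so that contraction with
    \<Omega> becomes an endomorphism.\<close>
  define L :: "'n model \<Rightarrow> 'n model \<Rightarrow> 'n model"
    where "L y x = (\<Sum>b\<in>Basis. \<Omega> c (cinv c y) x b *\<^sub>R b)" for y x
  define w where "w y = (\<Sum>b\<in>Basis. (- dfun c (\<lambda>q. \<mu> q $ k) (cinv c y) b) *\<^sub>R b)" for y
  have inner_L: "L y x \<bullet> b = \<Omega> c (cinv c y) x b" if "b \<in> Basis" for x y b
    using that by (simp add: L_def inner_sum_left_Basis)
  note S = chartD(2)[OF c]
  show ?thesis
  proof (rule smooth_on_solution[OF S, of L _ w])
    fix y assume y: "y \<in> cimg c"
    note p = chartD(4)[OF c y]
    note bil = bilinear_form[OF c p]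
    show lin: "linear (L y)"
      unfolding L_def
      by (rule linearI) (simp_all add: bilinear_ladd[OF bil] bilinear_lmul[OF bil]
          scaleR_add_left sum.distrib scaleR_sum_right)
    show "inj (L y)"
    proof (rule linear_injective_0[OF lin, THEN iffD2], intro allI impI)
      fix x assume "L y x = 0"
      then have "\<Omega> c (cinv c y) x b = 0" if "b \<in> Basis" for b
        using inner_L[OF that, of y x] by simp
      then have "\<Omega> c (cinv c y) x v = 0" for v
        using linear_basis_expansion[OF bil[unfolded bilinear_def, THEN conjunct1, rule_format], of x v] by simp
      then show "x = 0"
        by (rule nondegenerate[OF c p])
    qed
    show "L y (X k c (cinv c y)) = w y"
      by (simp add: L_def w_def form_X[OF c p])
  next
    show "smooth_on (cimg c) (\<lambda>y. L y v)" for v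
      unfolding L_def by (intro smooth_on_sum[OF S] smooth_on_scaleR[OF S] smooth_form[OF c] smooth_on_const)
    show "smooth_on (cimg c) w"
      unfolding w_def
    proof (intro smooth_on_sum[OF S] smooth_on_scaleR[OF S] smooth_on_minus[OF S] smooth_on_const)
      show "smooth_on (cimg c) (\<lambda>y. dfun c (\<lambda>q. \<mu> q $ k) (cinv c y) b)" for b
        by (rule smooth_on_cong[OF S _ smooth_on_D[OF smooth_moment[OF c, of k], of b]])
          (simp add: dfun_def o_def chartD(5)[OF c])
    qed
  qed
qed

context
  fixes c y
  assumes c: "c \<in> A" and y: "y \<in> cimg c"
begin

text \<open>Differentiating \<open>X_flow\<close> at the identity expresses derivatives of the
  fundamental fields as second derivatives of the flow.\<close>

lemma D_X_flow:
  "D (\<lambda>y. X k c (cinv c y)) y (D (flow c c) (0, y) w) = D (\<lambda>z. D (flow c c) z (e k, 0)) (0, y) w"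
proof -
  have "(\<lambda>y. X k c (cinv c y)) differentiable (at (flow c c (0, y)))"
    using smooth_on_differentiable[OF smooth_X[OF c] y] flow_0(2)[OF c y] by simp
  from has_derivative_compose[OF has_derivative_flow[OF c c flow_0(1)[OF c y]] has_derivative_D[OF this]]
  have "((\<lambda>z. X k c (cinv c (flow c c z))) has_derivative
      (\<lambda>w. D (\<lambda>y. X k c (cinv c y)) y (D (flow c c) (0, y) w))) (at (0, y))"
    using flow_0(2)[OF c y] by simp
  then have "((\<lambda>z. D (flow c c) z (e k, 0)) has_derivative
      (\<lambda>w. D (\<lambda>y. X k c (cinv c y)) y (D (flow c c) (0, y) w))) (at (0, y))"
  proof (rule has_derivative_transform_within_open[OF _ open_flow_dom[OF c c] flow_0(1)[OF c y]])
    show "X k c (cinv c (flow c c z)) = D (flow c c) z (e k, 0)" if "z \<in> flow_dom c c" for z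
      using X_flow[OF c] that by (cases z) simp
  qed
  from D_eqI[OF this] show ?thesis by simp
qed

lemma D_flow_0: "D (flow c c) (0, y) (0, v) = v" "D (flow c c) (0, y) (e k, 0) = X k c (cinv c y)"
proof -
  have "((\<lambda>y'. flow c c (0, y')) has_derivative (\<lambda>v. D (flow c c) (0, y) (0, v))) (at y)"
    by (rule has_derivative_compose[of "\<lambda>y'. (0, y')" "\<lambda>v. (0, v)" y UNIV])
      (auto intro!: derivative_eq_intros has_derivative_flow c flow_0(1) y)
  then have "((\<lambda>y'. y') has_derivative (\<lambda>v. D (flow c c) (0, y) (0, v))) (at y)"
    by (rule has_derivative_transform_within_open[OF _ chartD(2)[OF c] y]) (simp add: flow_0(2)[OF c])
  from has_derivative_unique[OF this has_derivative_ident]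
  show "D (flow c c) (0, y) (0, v) = v" by metis
  show "D (flow c c) (0, y) (e k, 0) = X k c (cinv c y)"
    using X_flow[OF c flow_0(1)[OF c y]] flow_0(2)[OF c y] by simp
qed

lemmas flow_second_derivative =
  second_derivative_symmetric[OF open_flow_dom[OF c c] flow_0(1)[OF c y] smooth_flow[OF c c]]

text \<open>Both sides are the mixed second derivative of the flow along \<open>e k\<close> and
  \<open>e l\<close>.\<close>

lemma X_commute:
  "D (\<lambda>y. X k c (cinv c y)) y (X l c (cinv c y)) = D (\<lambda>y. X l c (cinv c y)) y (X k c (cinv c y))"
  using D_X_flow[of k "(e l, 0)"] D_X_flow[of l "(e k, 0)"] flow_second_derivative
  by (simp add: D_flow_0)

text \<open>The vanishing of the Lie derivative of \<open>I\<close> along \<open>X k\<close>,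
  obtained by differentiating at time 0 the fact that \<open>I\<close> commutes with the
  differential of the flow.\<close>

lemma X_holomorphic:
  "D (\<lambda>y. I c (cinv c y) v) y (X k c (cinv c y)) =
    D (\<lambda>y. X k c (cinv c y)) y (I c (cinv c y) v) - I c (cinv c y) (D (\<lambda>y. X k c (cinv c y)) y v)"
proof -
  define \<gamma> where "\<gamma> s = (s *\<^sub>R e k, y)" for s
  have \<gamma>: "(\<gamma> has_derivative (\<lambda>h. (h *\<^sub>R e k, 0))) (at 0)" "\<gamma> 0 = (0, y)"
    unfolding \<gamma>_def by (auto intro!: derivative_eq_intros)
  define T where "T = \<gamma> -` flow_dom c c"
  have T: "open T" "0 \<in> T"
    using flow_0(1)[OF c y] unfolding T_def \<gamma>_def
    by (auto intro!: open_vimage open_flow_dom c continuous_intros)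
  have line: "((\<lambda>s. f (\<gamma> s)) has_derivative (\<lambda>h. D f (0, y) (h *\<^sub>R e k, 0))) (at 0)"
    if "f differentiable (at (0, y))" for f :: "_ \<Rightarrow> 'n model"
    by (rule has_derivative_compose[OF \<gamma>(1)]) (use that \<gamma>(2) in \<open>simp add: has_derivative_D\<close>)
  have dflow: "(\<lambda>z. D (flow c c) z w) differentiable (at (0, y))" for w
    by (rule smooth_on_differentiable[OF smooth_on_D[OF smooth_flow[OF c c]] flow_0(1)[OF c y]])
  \<comment> \<open>The time derivative of the differential of the flow is the differential of its
    velocity field.\<close>
  have second: "D (\<lambda>z. D (flow c c) z (0, w)) (0, y) (e k, 0) = D (\<lambda>y. X k c (cinv c y)) y w" for w
    using D_X_flow[of k "(0, w)"] flow_second_derivative by (simp add: D_flow_0)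
  define L where "L s w = I c (cinv c (flow c c (\<gamma> s))) w" for s w
  have L: "((\<lambda>s. L s w) has_derivative
      (\<lambda>h. D (\<lambda>y. I c (cinv c y) w) y (D (flow c c) (0, y) (h *\<^sub>R e k, 0)))) (at 0)" for w
    unfolding L_def
  proof (rule has_derivative_compose[OF line])
    show "flow c c differentiable at (0, y)"
      by (rule smooth_on_differentiable[OF smooth_flow[OF c c] flow_0(1)[OF c y]])
    show "((\<lambda>y. I c (cinv c y) w) has_derivative D (\<lambda>y. I c (cinv c y) w) y) (at (flow c c (\<gamma> 0)))"
      using smooth_on_differentiable[OF smooth_I[OF c] y] by (simp add: \<gamma> flow_0(2)[OF c y] has_derivative_D)
  qed
  have lin: "linear (L s)" if "s \<in> T" for s
  proof -
    have "cinv c (flow c c (\<gamma> s)) \<in> cdom c"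
      using that chartD(3)[OF c] by (simp add: T_def \<gamma>_def flow_dom_def flow_def)
    moreover have "L s = I c (cinv c (flow c c (\<gamma> s)))"
      by (simp add: L_def fun_eq_iff)
    ultimately show ?thesis
      using linear_I[OF c] by simp
  qed
  have "((\<lambda>s. L s (D (flow c c) (\<gamma> s) (0, v))) has_derivative
      (\<lambda>h. D (\<lambda>s. L s (D (flow c c) (\<gamma> 0) (0, v))) 0 h
        + L 0 (D (\<lambda>z. D (flow c c) z (0, v)) (0, y) (h *\<^sub>R e k, 0)))) (at 0)"
    by (rule has_derivative_apply[OF T lin _ line[OF dflow]]) (use L in \<open>auto simp: differentiable_def\<close>)
  \<comment> \<open>By invariance the curve just differentiated is also the transport of the vector
    \<open>I v\<close>; comparing the two derivatives gives the claim.\<close>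
  then have "((\<lambda>s. D (flow c c) (\<gamma> s) (0, I c (cinv c y) v)) has_derivative
      (\<lambda>h. D (\<lambda>s. L s (D (flow c c) (\<gamma> 0) (0, v))) 0 h
        + L 0 (D (\<lambda>z. D (flow c c) z (0, v)) (0, y) (h *\<^sub>R e k, 0)))) (at 0)"
  proof (rule has_derivative_transform_within_open[OF _ T])
    fix s assume s: "s \<in> T"
    let ?p = "cinv c y" and ?z = "texp (s *\<^sub>R e k)"
    have p: "?p \<in> cdom c" "a ?z ?p \<in> cdom c"
      using s chartD(4)[OF c y] by (auto simp: T_def \<gamma>_def flow_dom_def)
    have "dmap c c (a ?z) ?p w = D (flow c c) (\<gamma> s) (0, w)" for w
    proof -
      have "((\<lambda>y. flow c c (s *\<^sub>R e k, y)) has_derivative (\<lambda>w. D (flow c c) (\<gamma> s) (0, w))) (at y)"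
        by (rule has_derivative_compose[of "\<lambda>y. (s *\<^sub>R e k, y)" "\<lambda>w. (0, w)" y UNIV])
          (use s has_derivative_flow[OF c c, of "\<gamma> s"] in \<open>auto simp: \<gamma>_def T_def intro!: derivative_eq_intros\<close>)
      moreover have "(\<lambda>y. flow c c (s *\<^sub>R e k, y)) = coord c \<circ> a ?z \<circ> cinv c"
        by (simp add: flow_def fun_eq_iff)
      ultimately show ?thesis
        using dmap_has_derivative[OF c c texp_in_torus p] chartD(5)[OF c y] has_derivative_unique
        by metis
    qed
    then show "L s (D (flow c c) (\<gamma> s) (0, v)) = D (flow c c) (\<gamma> s) (0, I c ?p v)"
      using I_dmap[OF c c texp_in_torus p, of v] chartD(3)[OF c p(2)]
      by (simp add: L_def \<gamma>_def flow_def)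
  qed
  from has_derivative_unique[OF this line[OF dflow]]
  have "D (\<lambda>s. L s (D (flow c c) (\<gamma> 0) (0, v))) 0 1
        + L 0 (D (\<lambda>z. D (flow c c) z (0, v)) (0, y) (1 *\<^sub>R e k, 0))
    = D (\<lambda>z. D (flow c c) z (0, I c (cinv c y) v)) (0, y) (1 *\<^sub>R e k, 0)"
    by metis
  then show ?thesis
    using D_eqI[OF L] by (simp add: second \<gamma>(2) D_flow_0 L_def flow_0(2)[OF c y] algebra_simps)
qed

text \<open>\<mu> is constant on orbits, so its composition with the flow has no derivative in the
  Lie algebra directions.\<close>

lemma dfun_moment_X: "dfun c (\<lambda>q. \<mu> q $ l) (cinv c y) (X k c (cinv c y)) = 0"
proof -
  note p = chartD(4)[OF c y]
  have "((\<lambda>y. \<mu> (cinv c y) $ l) has_derivative dfun c (\<lambda>q. \<mu> q $ l) (cinv c y)) (at (flow c c (0, y)))"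
    using moment_has_derivative[OF c p] chartD(5)[OF c y] flow_0(2)[OF c y] by simp
  from has_derivative_compose[OF has_derivative_flow[OF c c flow_0(1)[OF c y]] this]
  have "((\<lambda>z. \<mu> (cinv c (snd z)) $ l) has_derivative
      (\<lambda>w. dfun c (\<lambda>q. \<mu> q $ l) (cinv c y) (D (flow c c) (0, y) w))) (at (0, y))"
  proof (rule has_derivative_transform_within_open[OF _ open_flow_dom[OF c c] flow_0(1)[OF c y]])
    show "\<mu> (cinv c (flow c c z)) $ l = \<mu> (cinv c (snd z)) $ l" if "z \<in> flow_dom c c" for z
      using that chartD(3)[OF c] moment_invariant[OF texp_in_torus]
      by (cases z) (simp add: flow_def flow_dom_def)
  qed
  moreover have "((\<lambda>z. \<mu> (cinv c (snd z)) $ l) has_derivative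
      (\<lambda>w. dfun c (\<lambda>q. \<mu> q $ l) (cinv c y) (snd w))) (at (0, y))"
    using moment_has_derivative[OF c p] chartD(5)[OF c y]
    by (intro has_derivative_compose[OF has_derivative_snd[OF has_derivative_ident]]) simp
  ultimately have "dfun c (\<lambda>q. \<mu> q $ l) (cinv c y) (D (flow c c) (0, y) (e k, 0))
      = dfun c (\<lambda>q. \<mu> q $ l) (cinv c y) (snd (e k, 0))"
    using has_derivative_unique by metis
  then show ?thesis
    using linear_0[OF has_derivative_linear[OF moment_has_derivative[OF c p]]] by (simp add: D_flow_0)
qed

end

lemma X_isotropic:
  assumes "c \<in> A" "p \<in> cdom c"
  shows "\<Omega> c p (X k c p) (X l c p) = 0"
  using dfun_moment_X[OF assms(1), of "coord c p" l k] assms chartD(3)[OF assms]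
  by (simp add: form_X'[OF assms])

subsection \<open>The sheared structures\<close>

context
  fixes c p
  assumes c: "c \<in> A" and p: "p \<in> cdom c"
begin

lemmas bil = bilinear_form[OF c p]

lemma linear_form: "linear (\<Omega> c p u)" "linear (\<lambda>u. \<Omega> c p u v)"
  using bil unfolding bilinear_def by blast+

lemma linear_shear: "linear (shear C \<Omega> X c p)"
  unfolding shear_def
  by (rule linearI) (simp_all add: bilinear_ladd[OF bil] bilinear_lmul[OF bil] algebra_simps
      scaleR_add_left sum.distrib scaleR_sum_right)

lemma shear_X: "shear C \<Omega> X c p (X k c p) = 0"
  by (simp add: shear_def X_isotropic[OF c p])

lemma shear_in_span: "shear C \<Omega> X c p v \<in> span (range (\<lambda>j. X j c p))"
  unfolding shear_def by (intro span_sum span_scale span_base) auto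

lemma shear_span: "w \<in> span (range (\<lambda>j. X j c p)) \<Longrightarrow> shear C \<Omega> X c p w = 0"
  using linear_eq_0_on_span[OF linear_shear] shear_X by (metis (no_types, lifting) rangeE)

text \<open>The signs from the antisymmetry of \<open>C\<close> and of \<Omega> cancel, and
  exchanging the summations moves the shear to the other argument.\<close>

lemma shear_self_adjoint:
  assumes C: "transpose C = - C"
  shows "\<Omega> c p (shear C \<Omega> X c p u) v = \<Omega> c p u (shear C \<Omega> X c p v)"
proof -
  have C: "C $ j $ k = - C $ k $ j" for j k
    using arg_cong[OF C, of "\<lambda>C. C $ k $ j"] by (simp add: transpose_def)
  have "\<Omega> c p (shear C \<Omega> X c p u) v =
      (\<Sum>k\<in>UNIV. \<Sum>j\<in>UNIV. C $ k $ j * \<Omega> c p u (X k c p) * \<Omega> c p (X j c p) v)"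
    by (simp add: shear_def linear_sum[OF linear_form(2)] linear_cmul[OF linear_form(2)])
  also have "\<dots> = (\<Sum>k\<in>UNIV. \<Sum>j\<in>UNIV. C $ j $ k * \<Omega> c p u (X k c p) * \<Omega> c p v (X j c p))"
    by (intro sum.cong refl) (subst C, subst skew_form[OF c p], simp)
  also have "\<dots> = (\<Sum>j\<in>UNIV. \<Sum>k\<in>UNIV. C $ j $ k * \<Omega> c p u (X k c p) * \<Omega> c p v (X j c p))"
    by (rule sum.swap)
  also have "\<dots> = \<Omega> c p u (shear C \<Omega> X c p v)"
    by (simp add: shear_def linear_sum[OF linear_form(1)] linear_cmul[OF linear_form(1)] mult_ac)
  finally show ?thesis .
qed

text \<open>\<open>N N = 0\<close> since the shear takes values in the span of the fundamental
  fields, on which it vanishes by isotropy.\<close>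

lemma hermitian_shear:
  assumes "transpose C = - C"
  shows "hermitian_shear (\<Omega> c p) (I c p) (shear C \<Omega> X c p)"
  by (rule hermitian_shear.intro) (simp_all add: bil alternating_form c p linear_I I_I I_compatible
      I_positive linear_shear shear_span shear_in_span shear_self_adjoint assms)

lemma shear_uminus: "shear (- C) \<Omega> X c p v = - shear C \<Omega> X c p v"
  by (simp add: shear_def sum_negf)

end

lemma smooth_shear:
  assumes c: "c \<in> A"
  shows "smooth_on (cimg c) (\<lambda>y. shear C \<Omega> X c (cinv c y) v)"
proof -
  note S = chartD(2)[OF c]
  have "smooth_on (cimg c) (\<lambda>y. \<Omega> c (cinv c y) v (X k c (cinv c y)))" for k
    by (rule smooth_on_apply[OF S linear_form(1)[OF c chartD(4)[OF c]] smooth_form[OF c] smooth_X[OF c]])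
  note form = smooth_on_linear[OF S bounded_linear_mult_right this]
  show ?thesis
    unfolding shear_def by (intro smooth_on_sum[OF S] smooth_on_scaleR[OF S] form smooth_X[OF c])
qed

lemma shear_dmap:
  assumes "c \<in> A" "d \<in> A" "z \<in> torus" "p \<in> cdom c" "a z p \<in> cdom d"
  shows "shear C \<Omega> X d (a z p) (dmap c d (a z) p v) = dmap c d (a z) p (shear C \<Omega> X c p v)"
  by (simp add: shear_def X_dmap[OF assms] form_dmap[OF assms] linear_sum[OF linear_dmap[OF assms]]
      linear_cmul[OF linear_dmap[OF assms]])

section \<open>Complex structures that solve the shear equation\<close>

context
  fixes C :: "real ^ 'n ^ 'n" and J :: "('a, 'n model) endo"
  assumes antisym: "transpose C = - C"
    and J: "\<And>c p v. c \<in> A \<Longrightarrow> p \<in> cdom c \<Longrightarrow>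
      J c p v - I c p (shear C \<Omega> X c p (J c p v)) = I c p v + shear C \<Omega> X c p v"
begin

lemma
  assumes "c \<in> A" "p \<in> cdom c"
  shows sheared_linear: "linear (J c p)"
    and sheared_sheared: "J c p (J c p v) = - v"
    and sheared_positive: "v \<noteq> 0 \<Longrightarrow> \<Omega> c p v (J c p v) > 0"
    and sheared_image: "J c p ` span (range (\<lambda>j. X j c p)) = I c p ` span (range (\<lambda>j. X j c p))"
    and shear_eqI: "v - I c p (shear C \<Omega> X c p v) = w - I c p (shear C \<Omega> X c p w) \<Longrightarrow> v = w"
proof -
  interpret hermitian_shear "\<Omega> c p" "I c p" "shear C \<Omega> X c p"
    by (rule hermitian_shear[OF assms antisym])
  show "linear (J c p)" by (rule linear_J[OF J[OF assms]])
  show "J c p (J c p v) = - v" by (rule J_J[OF J[OF assms]])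
  show "v \<noteq> 0 \<Longrightarrow> \<Omega> c p v (J c p v) > 0" by (rule J_positive[OF J[OF assms]])
  show "J c p ` span (range (\<lambda>j. X j c p)) = I c p ` span (range (\<lambda>j. X j c p))"
    by (rule image_J[OF J[OF assms]]) (simp_all add: shear_span[OF assms] shear_in_span[OF assms])
  show "v = w" if "v - I c p (shear C \<Omega> X c p v) = w - I c p (shear C \<Omega> X c p w)"
    using that by (rule shear_eqI)
qed

text \<open>\<open>J v\<close> solves a linear equation with smooth coefficients and injective
  operator, so \<open>smooth_on_solution\<close> applies.\<close>

lemma sheared_smooth:
  assumes c: "c \<in> A"
  shows "smooth_on (cimg c) (\<lambda>y. J c (cinv c y) v)"
proof (rule smooth_on_solution[OF chartD(2)[OF c]])
  fix y assume "y \<in> cimg c"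
  then have p: "cinv c y \<in> cdom c" by (rule chartD(4)[OF c])
  interpret hermitian_shear "\<Omega> c (cinv c y)" "I c (cinv c y)" "shear C \<Omega> X c (cinv c y)"
    by (rule hermitian_shear[OF c p antisym])
  show "linear (\<lambda>v. v - I c (cinv c y) (shear C \<Omega> X c (cinv c y) v))"
    by (rule linear_shear)
  show "inj (\<lambda>v. v - I c (cinv c y) (shear C \<Omega> X c (cinv c y) v))"
    by (rule inj_shear)
  show "J c (cinv c y) v - I c (cinv c y) (shear C \<Omega> X c (cinv c y) (J c (cinv c y) v))
      = I c (cinv c y) v + shear C \<Omega> X c (cinv c y) v"
    by (rule J[OF c p])
next
  note S = chartD(2)[OF c]
  show "smooth_on (cimg c) (\<lambda>y. v - I c (cinv c y) (shear C \<Omega> X c (cinv c y) v))" for v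
    by (rule smooth_on_diff[OF S smooth_on_const smooth_on_apply[OF S
          linear_I[OF c chartD(4)[OF c]] smooth_I[OF c] smooth_shear[OF c]]])
  show "smooth_on (cimg c) (\<lambda>y. I c (cinv c y) v + shear C \<Omega> X c (cinv c y) v)"
    by (rule smooth_on_add[OF S smooth_I[OF c] smooth_shear[OF c]])
qed

text \<open>\<open>I\<close> and the shear are invariant, so both sides solve the same equation,
  whose solution is unique.\<close>

lemma sheared_invariant:
  assumes z: "z \<in> torus"
  shows "endo_invariant A (a z) J"
  unfolding endo_invariant_def
proof (intro ballI impI allI)
  fix c d p v assume c: "c \<in> A" and d: "d \<in> A" and p: "p \<in> cdom c" "a z p \<in> cdom d"
  note dmap = c d z p
  note lin = linear_add[OF linear_dmap[OF dmap]] linear_diff[OF linear_dmap[OF dmap]]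
  show "J d (a z p) (dmap c d (a z) p v) = dmap c d (a z) p (J c p v)"
  proof (rule shear_eqI[OF d p(2)])
    show "J d (a z p) (dmap c d (a z) p v)
        - I d (a z p) (shear C \<Omega> X d (a z p) (J d (a z p) (dmap c d (a z) p v)))
      = dmap c d (a z) p (J c p v) - I d (a z p) (shear C \<Omega> X d (a z p) (dmap c d (a z) p (J c p v)))"
      unfolding J[OF d p(2)] shear_dmap[OF dmap] I_dmap[OF dmap]
      unfolding lin[symmetric] J[OF c p(1)] ..
  qed
qed

text \<open>Reduction to \<open>nijenhuis_conjugate\<close>, where \<open>P\<close>, the composition
  of \<open>I\<close> with the shear, is the sum of the products of \<open>D (f k)\<close> and
  \<open>Z k\<close>. Most of the work is to show that the fields \<open>Z k\<close> are holomorphic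
  and commute.\<close>

lemma sheared_integrable:
  assumes c: "c \<in> A" and y: "y \<in> cimg c" and V: "smooth_on (cimg c) V" and W: "smooth_on (cimg c) W"
  shows "nijenhuis (\<lambda>z. J c (cinv c z)) V W y = 0"
proof -
  note S = chartD(2)[OF c]
  note p = chartD(4)[OF c y]
  note diff = smooth_on_differentiable[OF _ y]
  define f where "f k z = \<mu> (cinv c z) $ k" for k z
  define Y where "Y k z = (\<Sum>j\<in>UNIV. C $ k $ j *\<^sub>R X j c (cinv c z))" for k z
  define i where "i z = I c (cinv c z)" for z
  define jj where "jj z = J c (cinv c z)" for z
  define Z where "Z k z = i z (Y k z)" for k z
  define P where "P z v = (\<Sum>k\<in>UNIV. D (f k) z v *\<^sub>R Z k z)" for z v
  define DI where "DI u v = D (\<lambda>z. i z v) y u" for u v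
  define A' where "A' x w = (\<Sum>k\<in>UNIV. D (f k) y w *\<^sub>R D (Z k) y x)" for x w
  define Q where "Q u v = D (\<lambda>z. P z v) y u" for u v

  have f: "smooth_on (cimg c) (f k)" for k
    unfolding f_def by (rule smooth_moment[OF c])
  have i_smooth: "smooth_on (cimg c) (\<lambda>z. i z v)" and jj_smooth: "smooth_on (cimg c) (\<lambda>z. jj z v)" for v
    unfolding i_def jj_def by (rule smooth_I[OF c], rule sheared_smooth[OF c])
  have i: "linear (i z)" "i z (i z v) = - v" and jj: "linear (jj z)" "jj z (jj z v) = - v"
    if "z \<in> cimg c" for z v
    using c chartD(4)[OF c that]
    by (simp_all add: i_def jj_def linear_I I_I sheared_linear sheared_sheared)
  have Y: "smooth_on (cimg c) (Y k)" for k
    unfolding Y_def by (intro smooth_on_sum[OF S] smooth_on_scaleR[OF S] smooth_on_const smooth_X[OF c])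
  have Z: "smooth_on (cimg c) (Z k)" for k
    unfolding Z_def by (rule smooth_on_apply[OF S i(1) i_smooth Y])
  have P_eq: "i z (shear C \<Omega> X c (cinv c z) v) = P z v" if z: "z \<in> cimg c" for z v
  proof -
    note q = chartD(4)[OF c z]
    have "\<Omega> c (cinv c z) v (X k c (cinv c z)) = D (f k) z v" for k
      using form_X'[OF c q] chartD(5)[OF c z] by (simp add: dfun_def o_def f_def[abs_def])
    then have "shear C \<Omega> X c (cinv c z) v = (\<Sum>k\<in>UNIV. D (f k) z v *\<^sub>R Y k z)"
      by (simp add: shear_def Y_def scaleR_sum_right mult.commute)
    then show ?thesis
      by (simp add: P_def Z_def linear_sum[OF i(1)[OF z]] linear_cmul[OF i(1)[OF z]])
  qed
  have lin_f: "linear (D (f k) z)" if "z \<in> cimg c" for k z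
    by (rule linear_frechet_derivative[OF smooth_on_differentiable[OF f that]])
  have lin_P: "linear (P z)" if "z \<in> cimg c" for z
    unfolding P_def by (rule linearI) (simp_all add: linear_add[OF lin_f[OF that]]
        linear_cmul[OF lin_f[OF that]] scaleR_add_left sum.distrib scaleR_sum_right)
  have P_inj: "v = w" if "v - P y v = w - P y w" for v w
    by (rule shear_eqI[OF c p]) (use that P_eq[OF y] in \<open>simp add: i_def\<close>)
  have jP: "jj z v - P z (jj z v) = i z (v - P z v)" if "z \<in> cimg c" for z v
  proof -
    note q = chartD(4)[OF c that]
    have "jj z v - P z (jj z v) = i z v + shear C \<Omega> X c (cinv c z) v"
      using J[OF c q, of v] P_eq[OF that] by (simp add: i_def jj_def)
    also have "\<dots> = i z (v - P z v)"
      using P_eq[OF that, of v, symmetric] i(2)[OF that] by (simp add: linear_diff[OF i(1)[OF that]])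
    finally show ?thesis .
  qed

  have DZ: "D (Z k) y u = DI u (Y k y) + i y (D (Y k) y u)" for k u
  proof -
    have "(Z k has_derivative (\<lambda>u. D (\<lambda>z. i z (Y k y)) y u + i y (D (Y k) y u))) (at y)"
      unfolding Z_def
      by (rule has_derivative_apply[OF S y i(1) diff[OF i_smooth] has_derivative_D[OF diff[OF Y]]])
    from D_eqI[OF this] show ?thesis by (simp add: DI_def)
  qed
  have lin_DI: "linear (\<lambda>u. DI u v)" "linear (\<lambda>v. DI u v)" for u v
  proof -
    show "linear (\<lambda>u. DI u v)"
      unfolding DI_def by (rule linear_frechet_derivative[OF diff[OF i_smooth]])
    show "linear (\<lambda>v. DI u v)"
      unfolding DI_def by (rule linear_D_field[OF S y i(1) diff[OF i_smooth]])
  qed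
  have lin_DY: "linear (D (Y k) y)" and lin_DZ: "linear (D (Z k) y)" for k
    by (rule linear_frechet_derivative[OF diff[OF Y]], rule linear_frechet_derivative[OF diff[OF Z]])
  have DY: "D (Y k) y u = (\<Sum>j\<in>UNIV. C $ k $ j *\<^sub>R D (\<lambda>z. X j c (cinv c z)) y u)" for k u
  proof -
    have "(Y k has_derivative (\<lambda>u. \<Sum>j\<in>UNIV. C $ k $ j *\<^sub>R D (\<lambda>z. X j c (cinv c z)) y u)) (at y)"
      unfolding Y_def
      by (intro has_derivative_sum has_derivative_scaleR_right has_derivative_D[OF diff[OF smooth_X[OF c]]])
    from D_eqI[OF this] show ?thesis by simp
  qed
  have Y_hol: "DI (Y k y) v = D (Y k) y (i y v) - i y (D (Y k) y v)" for k v
  proof -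
    have "DI (X j c (cinv c y)) v =
      D (\<lambda>z. X j c (cinv c z)) y (i y v) - i y (D (\<lambda>z. X j c (cinv c z)) y v)" for j
      unfolding DI_def i_def by (rule X_holomorphic[OF c y])
    then show ?thesis
      unfolding DY by (simp add: Y_def linear_sum[OF lin_DI(1)] linear_cmul[OF lin_DI(1)]
          linear_sum[OF i(1)[OF y]] linear_cmul[OF i(1)[OF y]] scaleR_diff_right sum_subtractf)
  qed
  have Y_comm: "D (Y k) y (Y l y) = D (Y l) y (Y k y)" for k l
  proof -
    let ?s = "\<lambda>j m. D (\<lambda>z. X j c (cinv c z)) y (X m c (cinv c y))"
    have lin_DX: "linear (D (\<lambda>z. X j c (cinv c z)) y)" for j
      by (rule linear_frechet_derivative[OF diff[OF smooth_X[OF c]]])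
    have YY: "D (Y k) y (Y l y) = (\<Sum>j\<in>UNIV. \<Sum>m\<in>UNIV. (C $ k $ j * C $ l $ m) *\<^sub>R ?s j m)" for k l
      unfolding DY by (simp add: Y_def linear_sum[OF lin_DX] linear_cmul[OF lin_DX] scaleR_sum_right)
    have "D (Y k) y (Y l y) = (\<Sum>j\<in>UNIV. \<Sum>m\<in>UNIV. (C $ k $ j * C $ l $ m) *\<^sub>R ?s m j)"
      unfolding YY by (simp only: X_commute[OF c y])
    also have "\<dots> = (\<Sum>m\<in>UNIV. \<Sum>j\<in>UNIV. (C $ k $ j * C $ l $ m) *\<^sub>R ?s m j)"
      by (rule sum.swap)
    also have "\<dots> = D (Y l) y (Y k y)"
      unfolding YY by (simp add: mult.commute)
    finally show ?thesis .
  qed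
  \<comment> \<open>On constant fields the Nijenhuis tensor of \<open>I\<close> involves only
    \<open>I\<close> and its derivatives.\<close>
  have integrable: "DI (i y u) v - i y (DI u v) = DI (i y v) u - i y (DI v u)" for u v
  proof -
    have "nijenhuis i (\<lambda>z. u) (\<lambda>z. v) y = 0"
      unfolding i_def by (intro I_integrable c y smooth_on_const)
    moreover have "nijenhuis i (\<lambda>z. u) (\<lambda>z. v) y =
        DI (i y u) v - DI (i y v) u - i y (DI u v - DI v u)"
      unfolding DI_def
      by (rule nijenhuis_tensorial[OF S y i(1) diff[OF i_smooth] i(2)[OF y]]) simp_all
    ultimately show ?thesis
      by (simp add: linear_diff[OF i(1)[OF y]] algebra_simps)
  qed
  note i_simps = linear_add[OF i(1)[OF y]] linear_diff[OF i(1)[OF y]] i(2)[OF y]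
  \<comment> \<open>Integrability of \<open>I\<close> carries holomorphy over from
    \<open>Y k\<close> to \<open>I (Y k)\<close>.\<close>
  have Z_hol: "DI (Z k y) v = D (Z k) y (i y v) - i y (D (Z k) y v)" for k v
  proof -
    have "DI (Z k y) v = i y (DI (Y k y) v) + DI (i y v) (Y k y) - i y (DI v (Y k y))"
      using integrable[of "Y k y" v] unfolding Z_def by (simp add: algebra_simps)
    then show ?thesis
      unfolding DZ Y_hol by (simp add: i_simps)
  qed
  \<comment> \<open>Combines holomorphy of \<open>Z l\<close> along \<open>Y k\<close>, holomorphy
    of \<open>Y k\<close> along \<open>Y l\<close>, and commutation of the \<open>Y\<close>
    fields.\<close>
  have Z_comm: "D (Z k) y (Z l y) = D (Z l) y (Z k y)" for k l
  proof -
    have "DI (Z l y) (Y k y) = D (Z l) y (Z k y) - i y (D (Z l) y (Y k y))"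
      using Z_hol[of l "Y k y"] by (simp add: Z_def)
    moreover have "D (Y k) y (Z l y) = DI (Y k y) (Y l y) + i y (D (Y k) y (Y l y))"
      using Y_hol[of k "Y l y"] by (simp add: Z_def)
    ultimately show ?thesis
      by (subst DZ) (simp add: DZ[of l "Y k y"] i_simps Y_comm[of k l])
  qed

  have D_P: "Q u v = (\<Sum>k\<in>UNIV. D (f k) y v *\<^sub>R D (Z k) y u + D (\<lambda>z. D (f k) z v) y u *\<^sub>R Z k y)" for u v
  proof -
    have "((\<lambda>z. P z v) has_derivative
      (\<lambda>u. \<Sum>k\<in>UNIV. D (f k) y v *\<^sub>R D (Z k) y u + D (\<lambda>z. D (f k) z v) y u *\<^sub>R Z k y)) (at y)"
      unfolding P_def
      by (intro has_derivative_sum has_derivative_scaleR has_derivative_D[OF diff[OF smooth_on_D[OF f]]]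
          has_derivative_D[OF diff[OF Z]])
    from D_eqI[OF this] show ?thesis by (simp add: Q_def)
  qed
  have P_smooth: "smooth_on (cimg c) (\<lambda>z. P z v)" for v
    unfolding P_def by (intro smooth_on_sum[OF S] smooth_on_scaleR[OF S] smooth_on_D[OF f] Z)

  have "D (\<lambda>z. jj z v) y (jj y u) - D (\<lambda>z. jj z u) y (jj y v)
      - jj y (D (\<lambda>z. jj z v) y u - D (\<lambda>z. jj z u) y v) = 0" for u v
  proof (rule nijenhuis_conjugate[of "i y" "P y" "jj y" DI A' "\<lambda>u v. D (\<lambda>z. jj z v) y u" Q])
    show "v = 0" if "v - P y v = 0" for v
      using P_inj[of v 0] that by (simp add: linear_0[OF lin_P[OF y]])
    show "linear (\<lambda>x. A' x w)" for w
      unfolding A'_def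
      by (rule linearI) (simp_all add: linear_add[OF lin_DZ] linear_cmul[OF lin_DZ]
          scaleR_add_right sum.distrib scaleR_sum_right mult.commute)
    \<comment> \<open>Derivative of the two sides of \<open>jP\<close>, which agree on the whole
      chart image.\<close>
    show "D (\<lambda>z. jj z v) y u - P y (D (\<lambda>z. jj z v) y u)
        = DI u (v - P y v) - i y (Q u v) + Q u (jj y v)" for u v
    proof -
      have 1: "((\<lambda>z. jj z v - P z (jj z v)) has_derivative
          (\<lambda>u. D (\<lambda>z. jj z v) y u - (Q u (jj y v) + P y (D (\<lambda>z. jj z v) y u)))) (at y)"
        unfolding Q_def
        by (rule has_derivative_diff[OF has_derivative_D[OF diff[OF jj_smooth]]
              has_derivative_apply[OF S y lin_P diff[OF P_smooth] has_derivative_D[OF diff[OF jj_smooth]]]])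
      have "((\<lambda>z. i z (v - P z v)) has_derivative
          (\<lambda>u. D (\<lambda>z. i z (v - P y v)) y u + i y (0 - D (\<lambda>z. P z v) y u))) (at y)"
        by (rule has_derivative_apply[OF S y i(1) diff[OF i_smooth] has_derivative_diff[OF
              has_derivative_const has_derivative_D[OF diff[OF P_smooth]]]])
      then have "((\<lambda>z. jj z v - P z (jj z v)) has_derivative
          (\<lambda>u. D (\<lambda>z. i z (v - P y v)) y u + i y (0 - D (\<lambda>z. P z v) y u))) (at y)"
        by (rule has_derivative_transform_within_open[OF _ S y]) (simp add: jP)
      from has_derivative_unique[OF 1 this]
      have "D (\<lambda>z. jj z v) y u - (Q u (jj y v) + P y (D (\<lambda>z. jj z v) y u)) =
          DI u (v - P y v) + i y (0 - Q u v)"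
        unfolding DI_def Q_def by metis
      then show ?thesis
        by (simp add: linear_neg[OF i(1)[OF y]] algebra_simps)
    qed
    \<comment> \<open>The second derivatives of \<open>f k\<close> are symmetric and drop out of the
      skew part.\<close>
    show "Q u v - Q v u = A' u v - A' v u" for u v
      using second_derivative_symmetric[OF S y f]
      by (simp add: D_P A'_def sum.distrib)
    show "DI (P y w) v = A' (i y v) w - i y (A' v w)" for w v
      unfolding A'_def P_def
      by (simp add: linear_sum[OF lin_DI(1)] linear_cmul[OF lin_DI(1)] linear_sum[OF i(1)[OF y]]
          linear_cmul[OF i(1)[OF y]] Z_hol scaleR_diff_right sum_subtractf)
    show "A' (P y u) v = A' (P y v) u" for u v
    proof -
      have AP: "A' (P y u) v =
          (\<Sum>k\<in>UNIV. \<Sum>l\<in>UNIV. (D (f k) y v * D (f l) y u) *\<^sub>R D (Z k) y (Z l y))" for u v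
        by (simp add: A'_def P_def linear_sum[OF lin_DZ] linear_cmul[OF lin_DZ] scaleR_sum_right)
      have "A' (P y u) v = (\<Sum>k\<in>UNIV. \<Sum>l\<in>UNIV. (D (f k) y v * D (f l) y u) *\<^sub>R D (Z l) y (Z k y))"
        unfolding AP by (simp only: Z_comm)
      also have "\<dots> = (\<Sum>l\<in>UNIV. \<Sum>k\<in>UNIV. (D (f k) y v * D (f l) y u) *\<^sub>R D (Z l) y (Z k y))"
        by (rule sum.swap)
      also have "\<dots> = A' (P y v) u"
        unfolding AP by (simp add: mult.commute)
      finally show ?thesis .
    qed
  qed (use y in \<open>simp_all add: i lin_P jP lin_DI integrable\<close>)
  \<comment> \<open>Tensoriality carries the identity for fixed vectors over to the fields
    \<open>V\<close> and \<open>W\<close>.\<close>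
  moreover have "nijenhuis jj V W y =
      D (\<lambda>z. jj z (W y)) y (jj y (V y)) - D (\<lambda>z. jj z (V y)) y (jj y (W y))
      - jj y (D (\<lambda>z. jj z (W y)) y (V y) - D (\<lambda>z. jj z (V y)) y (W y))"
    by (rule nijenhuis_tensorial[OF S y jj(1) diff[OF jj_smooth] jj(2)[OF y] diff[OF V] diff[OF W]])
  ultimately show ?thesis
    by (simp add: jj_def[abs_def])
qed

lemma sheared_complex_structure: "complex_structure A J"
proof -
  \<comment> \<open>The transformation law of a tensor field is invariance under \<open>id\<close>,
    which is the action of the unit of the torus.\<close>
  have "a 1 = id"
    by (simp add: fun_eq_iff action_1)
  then have "endo_invariant A id J"
    using sheared_invariant[of 1] texp_in_torus[of 0] by (simp add: texp_0)
  then show ?thesis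
    unfolding complex_structure_def endo_field_def
    using sheared_linear sheared_smooth sheared_sheared sheared_integrable by blast
qed

end

text \<open>A pointwise solution \<open>K\<close> of the equation for \<open>- C\<close> exists by
  surjectivity; \<open>J_adjoint\<close> gives it the property that defines
  \<open>minus_structure\<close>, and nondegeneracy makes it unique. All results on sheared
  structures thus apply to the second structure.\<close>

lemma sheared_minus:
  assumes antisym: "transpose C = - C"
    and J: "\<And>c p v. c \<in> A \<Longrightarrow> p \<in> cdom c \<Longrightarrow>
      J c p v - I c p (shear C \<Omega> X c p (J c p v)) = I c p v + shear C \<Omega> X c p v"
    and c: "c \<in> A" and p: "p \<in> cdom c"
  shows "minus_structure \<Omega> J c p v - I c p (shear (- C) \<Omega> X c p (minus_structure \<Omega> J c p v))
    = I c p v + shear (- C) \<Omega> X c p v"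
proof -
  interpret hermitian_shear "\<Omega> c p" "I c p" "shear C \<Omega> X c p"
    by (rule hermitian_shear[OF c p antisym])
  interpret neg: hermitian_shear "\<Omega> c p" "I c p" "\<lambda>v. - shear C \<Omega> X c p v"
    by (rule negative)
  have "surj (\<lambda>v. v - I c p (- shear C \<Omega> X c p v))"
    by (rule neg.surj_shear)
  then have "\<forall>v. \<exists>w. I c p v - shear C \<Omega> X c p v = w - I c p (- shear C \<Omega> X c p w)"
    unfolding surj_def by blast
  then obtain K where "\<forall>v. I c p v - shear C \<Omega> X c p v = K v - I c p (- shear C \<Omega> X c p (K v))"
    by (rule choice[THEN exE])
  then have "I c p v - shear C \<Omega> X c p v = K v - I c p (- shear C \<Omega> X c p (K v))" for v
    by blast
  then have K: "\<And>v. K v + I c p (shear C \<Omega> X c p (K v)) = I c p v - shear C \<Omega> X c p v"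
    by (simp add: I_simps)
  have adj: "\<Omega> c p (K v) u = - \<Omega> c p v (J c p u)" for u
    by (rule J_adjoint[OF J[OF c p] K])
  have "minus_structure \<Omega> J c p v = K v"
    unfolding minus_structure_def
  proof (rule the_equality)
    show "\<forall>u. \<Omega> c p (K v) u = - \<Omega> c p v (J c p u)"
      using adj by blast
    show "w = K v" if "\<forall>u. \<Omega> c p w u = - \<Omega> c p v (J c p u)" for w
      by (rule nondegenerate_eq[OF c p]) (simp add: that adj)
  qed
  then show ?thesis
    using K[of v] by (simp add: shear_uminus[OF c p] I_simps)
qed

subsection \<open>Admissible charts\<close>

text \<open>The second half of the coordinates is \<mu>, whose differential is therefore a
  projection. Isotropy then kills the second component of \<open>X k\<close>, and admissibility
  prescribes the first.\<close>

lemma admissible_X: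
  assumes adm: "admissible_chart A a e \<mu> I c" and p: "p \<in> cdom c"
  shows "X k c p = del_theta k" "\<Omega> c p v (X k c p) = snd v $ k"
proof -
  have c: "c \<in> A"
    using adm by (simp add: admissible_chart_def)
  note q = chartD(3)[OF c p]
  have "((\<lambda>y. \<mu> (cinv c y) $ k) has_derivative dfun c (\<lambda>q. \<mu> q $ k) p) (at (coord c p))" for k
    by (rule moment_has_derivative[OF c p])
  then have "((\<lambda>y. snd y $ k) has_derivative dfun c (\<lambda>q. \<mu> q $ k) p) (at (coord c p))" for k
  proof (rule has_derivative_transform_within_open[OF _ chartD(2)[OF c]])
    show "coord c p \<in> cimg c" using p by simp
    show "\<mu> (cinv c y) $ k = snd y $ k" if "y \<in> cimg c" for y
      using adm chartD(4,5)[OF c that] unfolding admissible_chart_def by metis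
  qed
  moreover have "((\<lambda>y::'n model. snd y $ k) has_derivative (\<lambda>v. snd v $ k)) (at (coord c p))" for k
    by (intro bounded_linear_imp_has_derivative bounded_linear_compose[OF bounded_linear_vec_nth
        bounded_linear_snd])
  ultimately have moment: "dfun c (\<lambda>q. \<mu> q $ k) p = (\<lambda>v. snd v $ k)" for k
    using has_derivative_unique by blast
  show form: "\<Omega> c p v (X k c p) = snd v $ k" for v k
    by (simp add: form_X'[OF c p] moment)
  have "snd (X k c p) = 0"
    using form[of "X k c p"] X_isotropic[OF c p] by (simp add: vec_eq_iff)
  moreover have "fst (X k c p) = axis k 1"
    using adm p by (simp add: admissible_chart_def)
  ultimately show "X k c p = del_theta k"
    by (simp add: del_theta_def prod_eq_iff)
qed

text \<open>On \<open>del_mu k\<close> the right-hand side of the shear equation lies in the span of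
  the \<open>del_theta j\<close>, where the shear vanishes, so it is itself the solution. The values
  on \<open>del_theta k\<close> are then forced by \<open>J J = - 1\<close>.\<close>

lemma sheared_admissible:
  assumes antisym: "transpose C = - C"
    and J: "\<And>c p v. c \<in> A \<Longrightarrow> p \<in> cdom c \<Longrightarrow>
      J c p v - I c p (shear C \<Omega> X c p (J c p v)) = I c p v + shear C \<Omega> X c p v"
    and adm: "admissible_chart A a e \<mu> I c" and p: "p \<in> cdom c"
    and \<psi>: "\<And>k. I c p (del_mu k) = (\<Sum>j\<in>UNIV. \<psi> $ k $ j *\<^sub>R del_theta j)"
  shows "J c p (del_mu k) = (\<Sum>j\<in>UNIV. (\<psi> + C) $ k $ j *\<^sub>R del_theta j)"
    and "J c p (del_theta k) = - (\<Sum>j\<in>UNIV. matrix_inv (\<psi> + C) $ k $ j *\<^sub>R del_mu j)"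
proof -
  have c: "c \<in> A"
    using adm by (simp add: admissible_chart_def)
  note X = admissible_X[OF adm p]
  note linear_J = sheared_linear[OF antisym J c p] and J_J = sheared_sheared[OF antisym J c p]
  define \<phi> where "\<phi> = \<psi> + C"
  have shear: "shear C \<Omega> X c p v = (\<Sum>k\<in>UNIV. \<Sum>j\<in>UNIV. (C $ k $ j * snd v $ k) *\<^sub>R del_theta j)" for v
    unfolding shear_def X(2) by (simp only: X(1))
  have "shear C \<Omega> X c p (del_mu k) =
      (\<Sum>i\<in>UNIV. if i = k then \<Sum>j\<in>UNIV. C $ i $ j *\<^sub>R del_theta j else 0)" for k
    unfolding shear by (intro sum.cong) (auto simp: del_mu_def axis_def)
  then have shear_mu: "shear C \<Omega> X c p (del_mu k) = (\<Sum>j\<in>UNIV. C $ k $ j *\<^sub>R del_theta j)" for k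
    by simp
  have shear_theta: "shear C \<Omega> X c p (\<Sum>j\<in>UNIV. x j *\<^sub>R del_theta j) = 0" for x
    unfolding X(1)[symmetric] by (rule shear_span[OF c p]) (intro span_sum span_scale span_base rangeI)
  have mu: "J c p (del_mu k) = (\<Sum>j\<in>UNIV. \<phi> $ k $ j *\<^sub>R del_theta j)" for k
  proof (rule shear_eqI[OF antisym J c p])
    show "J c p (del_mu k) - I c p (shear C \<Omega> X c p (J c p (del_mu k)))
        = (\<Sum>j\<in>UNIV. \<phi> $ k $ j *\<^sub>R del_theta j)
          - I c p (shear C \<Omega> X c p (\<Sum>j\<in>UNIV. \<phi> $ k $ j *\<^sub>R del_theta j))"
      unfolding J[OF c p] shear_theta shear_mu \<psi> linear_0[OF linear_I[OF c p]]
      by (simp add: \<phi>_def scaleR_add_left sum.distrib)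
  qed
  then show "J c p (del_mu k) = (\<Sum>j\<in>UNIV. (\<psi> + C) $ k $ j *\<^sub>R del_theta j)"
    by (simp add: \<phi>_def)

  have J_mu: "J c p (0, x) = (x v* \<phi>, 0)" for x
  proof -
    have "(0, x) = (\<Sum>k\<in>UNIV. x $ k *\<^sub>R del_mu k)"
      by (simp add: prod_eq_iff fst_sum snd_sum del_mu_def vec_eq_iff axis_def if_distrib cong: if_cong)
    then have "J c p (0, x) = (\<Sum>k\<in>UNIV. x $ k *\<^sub>R (\<Sum>j\<in>UNIV. \<phi> $ k $ j *\<^sub>R del_theta j))"
      by (simp add: linear_sum[OF linear_J] linear_cmul[OF linear_J] mu)
    also have "\<dots> = (x v* \<phi>, 0)"
      by (simp add: prod_eq_iff fst_sum snd_sum del_theta_def vec_eq_iff axis_def vector_matrix_mult_def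
          if_distrib mult.commute cong: if_cong)
    finally show ?thesis .
  qed
  \<comment> \<open>A vector \<open>x\<close> with \<open>x v* \<phi> = 0\<close> gives
    \<open>J c p (0, x) = 0\<close>, and \<open>J J = - 1\<close> yields
    \<open>x = 0\<close>.\<close>
  have "invertible (transpose \<phi>)"
  proof -
    have "x = 0" if "transpose \<phi> *v x = 0" for x
      using J_mu[of x] J_J[of "(0, x)"] that linear_0[OF linear_J]
      by (simp add: transpose_matrix_vector zero_prod_def)
    then show ?thesis
      using matrix_left_invertible_ker[of "transpose \<phi>"] invertible_left_inverse by blast
  qed
  then have "invertible \<phi>"
    using transpose_invertible[of "transpose \<phi>"] by simp
  then have inv: "matrix_inv \<phi> ** \<phi> = mat 1"
    using someI_ex[of "\<lambda>B. \<phi> ** B = mat 1 \<and> B ** \<phi> = mat 1"]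
    by (simp add: invertible_def matrix_inv_def)
  \<comment> \<open>\<open>J\<close> sends row \<open>k\<close> of the inverse matrix to
    \<open>del_theta k\<close>, so a second application of \<open>J\<close> gives the value
    there.\<close>
  have row: "J c p (0, matrix_inv \<phi> $ k) = del_theta k" for k
  proof -
    have "matrix_inv \<phi> $ k v* \<phi> = (matrix_inv \<phi> ** \<phi>) $ k"
      by (simp add: vec_eq_iff vector_matrix_mult_def matrix_matrix_mult_def mult.commute)
    also have "\<dots> = axis k 1"
      by (simp add: inv mat_def axis_def vec_eq_iff)
    finally show ?thesis
      by (simp add: J_mu del_theta_def)
  qed
  have "J c p (del_theta k) = - (0, matrix_inv \<phi> $ k)"
    using J_J[of "(0, matrix_inv \<phi> $ k)"] row[of k] by simp
  also have "(0, matrix_inv \<phi> $ k) = (\<Sum>j\<in>UNIV. matrix_inv \<phi> $ k $ j *\<^sub>R del_mu j)"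
    by (simp add: prod_eq_iff fst_sum snd_sum del_mu_def vec_eq_iff axis_def if_distrib cong: if_cong)
  finally show "J c p (del_theta k) = - (\<Sum>j\<in>UNIV. matrix_inv (\<psi> + C) $ k $ j *\<^sub>R del_mu j)"
    by (simp add: \<phi>_def)
qed

end

theorem theorem4p11:
  fixes A :: "('a::{t2_space,second_countable_topology}, 'n::finite model) chart set"
    and \<Omega> :: "('a, 'n model) form2"
    and a :: "complex ^ 'n \<Rightarrow> 'a \<Rightarrow> 'a"
    and e :: "'n \<Rightarrow> real ^ 'n"
    and \<mu> :: "'a \<Rightarrow> real ^ 'n"
    and I :: "('a, 'n model) endo"
    and \<tau> :: "real ^ 'n \<Rightarrow> real"
    and C :: "real ^ 'n ^ 'n"
  assumes toric: "toric_symplectic_manifold A \<Omega> a e \<mu>"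
    and kaehler: "I \<in> toric_Kaehler A \<Omega> a"
    and potential: "symplectic_potential A a e \<mu> I \<tau>"
    and antisym: "transpose C = - C"
  shows "\<exists>J \<in> DGK A \<Omega> a e \<mu>.
    \<forall>c. admissible_chart A a e \<mu> I c \<longrightarrow> (\<forall>p\<in>cdom c. \<forall>k.
      (let \<phi> = Hess \<tau> (\<mu> p) + C in
        J c p (del_mu k) = (\<Sum>j\<in>UNIV. \<phi> $ k $ j *\<^sub>R del_theta j) \<and>
        J c p (del_theta k) = - (\<Sum>j\<in>UNIV. matrix_inv \<phi> $ k $ j *\<^sub>R del_mu j)))"
proof -
  interpret toric_kaehler_manifold A \<Omega> a e \<mu> I
    using toric kaehler by (rule toric_kaehler_manifold.intro)
  \<comment> \<open>The pointwise solution of the shear equation, which exists by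
    \<open>surj_shear\<close>; values outside chart domains are irrelevant.\<close>
  define J where "J c p v = inv (\<lambda>w. w - I c p (shear C \<Omega> X c p w)) (I c p v + shear C \<Omega> X c p v)" for c p v
  have J: "J c p v - I c p (shear C \<Omega> X c p (J c p v)) = I c p v + shear C \<Omega> X c p v"
    if "c \<in> A" "p \<in> cdom c" for c p v
  proof -
    interpret hermitian_shear "\<Omega> c p" "I c p" "shear C \<Omega> X c p"
      by (rule hermitian_shear[OF that antisym])
    show ?thesis
      unfolding J_def by (rule surj_f_inv_f[OF surj_shear])
  qed
  have "transpose (- C) = - transpose C"
    by (simp add: transpose_def vec_eq_iff)
  then have "transpose (- C) = - (- C)"
    by (simp only: antisym)
  \<comment> \<open>These facts are the hypotheses of the results on sheared structures, now for
    \<open>minus_structure \<Omega> J\<close> and \<open>- C\<close>.\<close>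
  note minus = this sheared_minus[OF antisym J]
  \<comment> \<open>The two images compared in \<open>DGK\<close> both equal the image of the span
    under \<open>I\<close>.\<close>
  have "J \<in> DGK A \<Omega> a e \<mu>"
    unfolding DGK_def GK_def tamed_def
    using sheared_complex_structure[OF antisym J] sheared_complex_structure[OF minus]
      sheared_invariant[OF antisym J] sheared_positive[OF antisym J]
      sheared_image[OF antisym J] sheared_image[OF minus] by auto
  moreover have "J c p (del_mu k) = (\<Sum>j\<in>UNIV. (Hess \<tau> (\<mu> p) + C) $ k $ j *\<^sub>R del_theta j)"
    "J c p (del_theta k) = - (\<Sum>j\<in>UNIV. matrix_inv (Hess \<tau> (\<mu> p) + C) $ k $ j *\<^sub>R del_mu j)"
    if "admissible_chart A a e \<mu> I c" "p \<in> cdom c" for c p k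
    using sheared_admissible[OF antisym J that] potential that
    unfolding symplectic_potential_def by blast+
  ultimately show ?thesis
    unfolding Let_def by blast
qed

end
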